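(* Let $p\ge 1$ and let $X,Y\in L^\infty(\mathbb{R}^2,\mathbb{R}^2)\cap W^{1,p}(\mathbb{R}^2,\mathbb{R}^2)$ be vector fields with bounded divergence such that $[X,Y]=0$. Then for every $\kappa\in\mathbb{R}\setminus\{0\}$ the restrictions of $X$ and $Y$ to $\Omega_\kappa$ are steady nearly incompressible in $\Omega_\kappa$. Moreover, they have the same Lipschitz and bounded density $\rho_\kappa:\Omega_\kappa\to\mathbb{R}$ given (up to the sign $-1$ when $\kappa<0$, needed to make it positive) by $$\rho_\kappa=\frac{1}{H_W};$$ that is, $\operatorname{div}(\rho_\kappa X)=\operatorname{div}(\rho_\kappa Y)=0$ in $\mathcal D'(\Omega_\kappa)$, and in particular $\operatorname{div}(\rho_\kappa(X-Y))=0$ in $\mathcal D'(\Omega_\kappa)$.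
   Context: $Y^\perp=(-Y_2,Y_1)$, $\nabla^\perp=(-\partial_2,\partial_1)$, $(\cdot,\cdot)$ is the Euclidean scalar product, $\mathcal L^n$ is Lebesgue measure, $(D\varphi\,Y)_i=\sum_j \partial_j\varphi_i\,Y_j$. Lie bracket: $[X,Y]$ is the distribution (for Sobolev fields it equals $DY\,X-DX\,Y$) defined by $$\int ([X,Y],\varphi)\,dz=\int\big((X,D\varphi\,Y)+\operatorname{div}Y\,(X,\varphi)-(Y,D\varphi\,X)-\operatorname{div}X\,(Y,\varphi)\big)\,dz,\quad \varphi\in C^1_c(\mathbb{R}^n,\mathbb{R}^n).$$ $H_W$: when $[X,Y]=0$, the function $X\cdot Y^\perp$ satisfies $\nabla^\perp(X\cdot Y^\perp)=W:=\operatorname{div}Y\,X-\operatorname{div}X\,Y\in L^\infty$, so it has a Lipschitz representative, denoted $H_W$. $\Omega_\kappa$: fix $T>0$ and a constant $C>1$ such that the Jacobian densities of the Regular Lagrangian Flows of $X$ and of $Y$ take values in $[C^{-1},C]$ a.e. for all times in $(-T,T)$ (such $C$ exists since the divergences are bounded). Here the Regular Lagrangian Flow $\phi^X_t$ of $X$ is the a.e. unique map solving $\partial_t\phi^X_t=X\circ\phi^X_t$, $\phi^X_0(x)=x$ distributionally and such that, for every $T>0$, $\mathcal L^2(\{x:\phi^X_t(x)\in A\})\le C_T\mathcal L^2(A)$ for Borel $A$ and $|t|\le T$, and its Jacobian density $\xi(t,\cdot)$ is defined by $\int\varphi(\phi^X_{-t}(z))\,dz=\int\varphi(z)\xi(t,z)\,dz$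 for $\varphi\in C_c(\mathbb{R}^2)$. Set $\Omega_\kappa=H_W^{-1}\big((C^{-1}\kappa,C\kappa)\big)$ if $\kappa>0$ and $\Omega_\kappa=H_W^{-1}\big((C\kappa,C^{-1}\kappa)\big)$ if $\kappa<0$. Steady nearly incompressible: a bounded vector field $X\in L^1_{\rm loc}$ is steady nearly incompressible in $\Omega$ if there are a constant $C'>0$ and a time-independent density $\rho:\Omega\to\mathbb{R}$ with $\operatorname{div}(\rho X)=0$ in $\mathcal D'(\Omega)$ and $\rho(x)\in[1/C',C']$ for a.e. $x\in\Omega$. *)

theory Defs
  imports "HOL-Analysis.Analysis"
begin
primrec Ck :: "nat \<Rightarrow> ('a::euclidean_space \<Rightarrow> 'b::euclidean_space) \<Rightarrow> bool" where
  "Ck 0 f \<longleftrightarrow> continuous_on UNIV f"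
| "Ck (Suc k) f \<longleftrightarrow>
     (\<forall>x. f differentiable (at x)) \<and> (\<forall>v. Ck k (\<lambda>x. frechet_derivative f (at x) v))"

definition compact_support_in :: "'a::euclidean_space set \<Rightarrow> ('a \<Rightarrow> 'b::euclidean_space) \<Rightarrow> bool" where
  "compact_support_in \<Omega> f \<longleftrightarrow>
     compact (closure {x. f x \<noteq> 0}) \<and> closure {x. f x \<noteq> 0} \<subseteq> \<Omega>"

definition Cc :: "('a::euclidean_space \<Rightarrow> 'b::euclidean_space) \<Rightarrow> bool" where
  "Cc f \<longleftrightarrow> Ck 0 f \<and> compact_support_in UNIV f"

definition C1c :: "('a::euclidean_space \<Rightarrow> 'b::euclidean_space) \<Rightarrow> bool" where
  "C1c f \<longleftrightarrow> Ck 1 f \<and> compact_support_in UNIV f"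

definition Cinfc :: "'a::euclidean_space set \<Rightarrow> ('a \<Rightarrow> 'b::euclidean_space) \<Rightarrow> bool" where
  "Cinfc \<Omega> f \<longleftrightarrow> (\<forall>k. Ck k f) \<and> compact_support_in \<Omega> f"

definition ess_bounded_on :: "'a::euclidean_space set \<Rightarrow> ('a \<Rightarrow> 'b::euclidean_space) \<Rightarrow> bool" where
  "ess_bounded_on \<Omega> f \<longleftrightarrow>
     f \<in> borel_measurable (lebesgue_on \<Omega>) \<and> (\<exists>B. AE x in lebesgue_on \<Omega>. norm (f x) \<le> B)"

definition loc_integrable_on :: "'a::euclidean_space set \<Rightarrow> ('a \<Rightarrow> 'b::euclidean_space) \<Rightarrow> bool" where
  "loc_integrable_on \<Omega> f \<longleftrightarrow>
     (\<forall>K. compact K \<and> K \<subseteq> \<Omega> \<longrightarrow> set_integrable lebesgue K f)"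

definition Lp :: "ereal \<Rightarrow> ('a::euclidean_space \<Rightarrow> 'b::euclidean_space) \<Rightarrow> bool" where
  "Lp p f \<longleftrightarrow>
     (if p = \<infinity> then ess_bounded_on UNIV f
      else f \<in> borel_measurable lebesgue \<and>
           integrable lebesgue (\<lambda>x. norm (f x) powr real_of_ereal p))"

text \<open>Weak partial derivatives and weak divergences of locally integrable functions are tested
  against \<open>C\<^sup>1\<^sub>c\<close> functions, as for the Lie bracket below; mollifying the test function shows that
  testing against \<open>C\<^sup>\<infinity>\<^sub>c\<close> functions gives the same notions.\<close>

definition has_weak_partial ::
    "'n \<Rightarrow> (real ^ 'n \<Rightarrow> 'b::euclidean_space) \<Rightarrow> (real ^ 'n::finite \<Rightarrow> 'b) \<Rightarrow> bool" where
  "has_weak_partial j f g \<longleftrightarrow>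
     loc_integrable_on UNIV f \<and> loc_integrable_on UNIV g \<and>
     (\<forall>\<eta> :: real ^ 'n \<Rightarrow> real. C1c \<eta> \<longrightarrow>
        (LINT z|lebesgue. frechet_derivative \<eta> (at z) (axis j 1) *\<^sub>R f z)
          = - (LINT z|lebesgue. \<eta> z *\<^sub>R g z))"

definition W1p :: "ereal \<Rightarrow> (real ^ 'n::finite \<Rightarrow> 'b::euclidean_space) \<Rightarrow> bool" where
  "W1p p f \<longleftrightarrow> Lp p f \<and> (\<forall>j. \<exists>g. Lp p g \<and> has_weak_partial j f g)"

text \<open>Throughout, \<open>frechet_derivative \<eta> (at z) (F z)\<close> is \<open>\<nabla>\<eta>(z) \<bullet> F(z)\<close> for a scalar
  \<open>\<eta>\<close>, and \<open>D\<phi>(z) F(z)\<close> for a vector-valued \<open>\<phi>\<close>.\<close>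

definition has_weak_div :: "(real ^ 'n \<Rightarrow> real ^ 'n) \<Rightarrow> (real ^ 'n::finite \<Rightarrow> real) \<Rightarrow> bool" where
  "has_weak_div F d \<longleftrightarrow>
     loc_integrable_on UNIV F \<and> loc_integrable_on UNIV d \<and>
     (\<forall>\<eta> :: real ^ 'n \<Rightarrow> real. C1c \<eta> \<longrightarrow>
        (LINT z|lebesgue. frechet_derivative \<eta> (at z) (F z)) = - (LINT z|lebesgue. \<eta> z * d z))"

text \<open>A weak divergence is unique up to null sets; \<open>weak_div F\<close> is a chosen representative, and is
  meaningful only when \<open>F\<close> has a weak divergence.\<close>

definition weak_div :: "(real ^ 'n \<Rightarrow> real ^ 'n) \<Rightarrow> real ^ 'n::finite \<Rightarrow> real" where
  "weak_div F = (SOME d. has_weak_div F d)"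

definition bounded_divergence :: "(real ^ 'n::finite \<Rightarrow> real ^ 'n) \<Rightarrow> bool" where
  "bounded_divergence F \<longleftrightarrow> (\<exists>d. has_weak_div F d \<and> ess_bounded_on UNIV d)"

definition lie_bracket ::
    "(real ^ 'n \<Rightarrow> real ^ 'n) \<Rightarrow> (real ^ 'n \<Rightarrow> real ^ 'n) \<Rightarrow> (real ^ 'n::finite \<Rightarrow> real ^ 'n) \<Rightarrow> real" where
  "lie_bracket X Y \<phi> =
     (LINT z|lebesgue.
        X z \<bullet> frechet_derivative \<phi> (at z) (Y z) + weak_div Y z * (X z \<bullet> \<phi> z)
      - Y z \<bullet> frechet_derivative \<phi> (at z) (X z) - weak_div X z * (Y z \<bullet> \<phi> z))"

definition commuting_fields :: "(real ^ 'n \<Rightarrow> real ^ 'n) \<Rightarrow> (real ^ 'n::finite \<Rightarrow> real ^ 'n) \<Rightarrow> bool" where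
  "commuting_fields X Y \<longleftrightarrow> (\<forall>\<phi>. C1c \<phi> \<longrightarrow> lie_bracket X Y \<phi> = 0)"

text \<open>The problem \<open>\<partial>\<^sub>t\<phi>\<^sub>t = X \<circ> \<phi>\<^sub>t\<close>, \<open>\<phi>\<^sub>0(x) = x\<close> in the sense of distributions: test
  functions on space-time need not vanish at time 0, so the forward and the backward equation
  each carry the initial datum as a boundary term.\<close>

definition distributional_flow ::
    "(real ^ 'n::finite \<Rightarrow> real ^ 'n) \<Rightarrow> (real \<Rightarrow> real ^ 'n \<Rightarrow> real ^ 'n) \<Rightarrow> bool" where
  "distributional_flow X \<phi> \<longleftrightarrow>
     loc_integrable_on UNIV (\<lambda>(t, x). \<phi> t x) \<and>
     loc_integrable_on UNIV (\<lambda>(t, x). X (\<phi> t x)) \<and>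
     (\<forall>\<eta> :: real \<times> (real ^ 'n) \<Rightarrow> real. Cinfc UNIV \<eta> \<longrightarrow>
        (LINT (t, x):{0..} \<times> UNIV|lebesgue.
            frechet_derivative \<eta> (at (t, x)) (1, 0) *\<^sub>R \<phi> t x + \<eta> (t, x) *\<^sub>R X (\<phi> t x))
          = - (LINT x|lebesgue. \<eta> (0, x) *\<^sub>R x) \<and>
        (LINT (t, x):{..0} \<times> UNIV|lebesgue.
            frechet_derivative \<eta> (at (t, x)) (1, 0) *\<^sub>R \<phi> t x + \<eta> (t, x) *\<^sub>R X (\<phi> t x))
          = (LINT x|lebesgue. \<eta> (0, x) *\<^sub>R x))"

definition regular_lagrangian_flow ::
    "(real ^ 'n::finite \<Rightarrow> real ^ 'n) \<Rightarrow> (real \<Rightarrow> real ^ 'n \<Rightarrow> real ^ 'n) \<Rightarrow> bool" where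
  "regular_lagrangian_flow X \<phi> \<longleftrightarrow>
     (\<forall>t. \<phi> t \<in> borel_measurable lebesgue) \<and>
     distributional_flow X \<phi> \<and>
     (\<forall>T>0. \<exists>C. \<forall>t\<in>{-T..T}. \<forall>A\<in>sets borel.
        emeasure lebesgue {x. \<phi> t x \<in> A} \<le> ennreal C * emeasure lebesgue A)"

definition jacobian_density ::
    "(real \<Rightarrow> real ^ 'n \<Rightarrow> real ^ 'n) \<Rightarrow> (real \<Rightarrow> real ^ 'n::finite \<Rightarrow> real) \<Rightarrow> bool" where
  "jacobian_density \<phi> \<xi> \<longleftrightarrow>
     (\<forall>t. loc_integrable_on UNIV (\<xi> t) \<and>
        (\<forall>\<eta> :: real ^ 'n \<Rightarrow> real. Cc \<eta> \<longrightarrow>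
           (LINT z|lebesgue. \<eta> (\<phi> (- t) z)) = (LINT z|lebesgue. \<eta> z * \<xi> t z)))"

definition jacobian_bounds :: "real \<Rightarrow> real \<Rightarrow> (real \<Rightarrow> real ^ 'n::finite \<Rightarrow> real) \<Rightarrow> bool" where
  "jacobian_bounds T C \<xi> \<longleftrightarrow> (\<forall>t\<in>{-T<..<T}. AE z in lebesgue. \<xi> t z \<in> {1 / C..C})"

definition perp :: "real ^ 2 \<Rightarrow> real ^ 2" where
  "perp y = vector [- (y $ 2), y $ 1]"

text \<open>Two continuous functions that agree almost everywhere are equal, so a Lipschitz representative
  is unique. It exists here when \<open>X\<close> and \<open>Y\<close> commute: then \<open>X \<bullet> Y\<^sup>\<bottom>\<close> has rotated gradient
  \<open>W = div Y X - div X Y\<close>, which is essentially bounded.\<close>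

definition H_W :: "(real ^ 2 \<Rightarrow> real ^ 2) \<Rightarrow> (real ^ 2 \<Rightarrow> real ^ 2) \<Rightarrow> real ^ 2 \<Rightarrow> real" where
  "H_W X Y =
     (THE H. (\<exists>L. L-lipschitz_on UNIV H) \<and> (AE z in lebesgue. H z = X z \<bullet> perp (Y z)))"

definition Omega ::
    "(real ^ 2 \<Rightarrow> real ^ 2) \<Rightarrow> (real ^ 2 \<Rightarrow> real ^ 2) \<Rightarrow> real \<Rightarrow> real \<Rightarrow> (real ^ 2) set" where
  "Omega X Y C \<kappa> =
     H_W X Y -` (if \<kappa> > 0 then {\<kappa> / C<..<C * \<kappa>} else {C * \<kappa><..<\<kappa> / C})"

text \<open>The notions below only depend on the values of the field and of the density on \<open>\<Omega>\<close>, so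
  they apply to restrictions to \<open>\<Omega>\<close>.\<close>

definition div_zero_on :: "(real ^ 'n) set \<Rightarrow> (real ^ 'n::finite \<Rightarrow> real ^ 'n) \<Rightarrow> bool" where
  "div_zero_on \<Omega> F \<longleftrightarrow>
     loc_integrable_on \<Omega> F \<and>
     (\<forall>\<eta> :: real ^ 'n \<Rightarrow> real. Cinfc \<Omega> \<eta> \<longrightarrow>
        (LINT z:\<Omega>|lebesgue. frechet_derivative \<eta> (at z) (F z)) = 0)"

definition steady_density ::
    "(real ^ 'n) set \<Rightarrow> (real ^ 'n::finite \<Rightarrow> real ^ 'n) \<Rightarrow> (real ^ 'n \<Rightarrow> real) \<Rightarrow> bool" where
  "steady_density \<Omega> X \<rho> \<longleftrightarrow>
     \<rho> \<in> borel_measurable (lebesgue_on \<Omega>) \<and>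
     div_zero_on \<Omega> (\<lambda>z. \<rho> z *\<^sub>R X z) \<and>
     (\<exists>C>0. AE z in lebesgue_on \<Omega>. \<rho> z \<in> {1 / C..C})"

definition steady_nearly_incompressible ::
    "(real ^ 'n) set \<Rightarrow> (real ^ 'n::finite \<Rightarrow> real ^ 'n) \<Rightarrow> bool" where
  "steady_nearly_incompressible \<Omega> X \<longleftrightarrow>
     ess_bounded_on \<Omega> X \<and> loc_integrable_on \<Omega> X \<and> (\<exists>\<rho>. steady_density \<Omega> X \<rho>)"

end

theory Submission
  imports Defs
begin

text \<open>Let \<open>h = X \<bullet> Y\<^sup>\<bottom>\<close> and \<open>W = div Y X - div X Y\<close>. For a scalar test function \<open>\<eta>\<close> and a fixed vector \<open>v\<close>,
  take \<open>\<phi> = \<eta> v\<^sup>\<bottom>\<close> in the definition of the bracket. In the plane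
  \<open>(X \<bullet> v\<^sup>\<bottom>) Y - (Y \<bullet> v\<^sup>\<bottom>) X = h v\<close>, so \<open>[X, Y] = 0\<close> says that \<open>h\<close> has the weak gradient \<open>g = - W\<^sup>\<bottom>\<close>
  (\<open>commuting_fields_weak_gradient\<close>). Both \<open>h\<close> and \<open>g\<close> are bounded, hence \<open>h\<close> has a Lipschitz
  representative \<open>H\<close> (\<open>lipschitz_representative\<close>), and this is \<open>H_W\<close>.

  Pointwise \<open>g \<bullet> X = W \<bullet> X\<^sup>\<bottom> = h div X\<close> and \<open>g \<bullet> Y = W \<bullet> Y\<^sup>\<bottom> = h div Y\<close>. Formally, therefore,
  \<open>div (X / h) = (h div X - g \<bullet> X) / h\<^sup>2 = 0\<close> wherever \<open>h \<noteq> 0\<close>, and the same holds for \<open>Y\<close> and, by linearity,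
  for \<open>X - Y\<close>. On \<open>\<Omega>\<^sub>\<kappa>\<close> the function \<open>H\<close> has the sign of \<open>\<kappa>\<close> and \<open>\<bar>H\<bar>\<close> lies between \<open>\<bar>\<kappa>\<bar> / C\<close> and \<open>C \<bar>\<kappa>\<bar>\<close>,
  which gives the bounds and the Lipschitz estimate for \<open>\<rho> = 1 / \<bar>H\<bar>\<close>.

  The formal computation is made rigorous by mollification: \<open>weak_div_chain_rule\<close> computes the
  divergence of \<open>\<theta>(h) X\<close> for \<open>\<theta>\<close> of class \<open>C\<^sup>1\<close>, and \<open>div_zero_on_divide\<close> applies it to a \<open>\<theta>\<close> that equals
  \<open>1 / s\<close> on the relevant range. The analytic input is the convergence of mollifications at Lebesgue
  points (\<open>AE_mollify_tendsto\<close>), which also yields the uniqueness of weak divergences.\<close>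

section \<open>Compactly supported functions of class \<open>C\<^sup>1\<close>\<close>

lemma C1cD_has_derivative:
  "C1c \<eta> \<Longrightarrow> (\<eta> has_derivative frechet_derivative \<eta> (at x)) (at x)"
  by (simp add: C1c_def frechet_derivative_works)

lemma C1cD_continuous_derivative:
  "C1c \<eta> \<Longrightarrow> continuous_on UNIV (\<lambda>x. frechet_derivative \<eta> (at x) v)"
  by (simp add: C1c_def)

lemma C1cD_linear: "C1c \<eta> \<Longrightarrow> linear (frechet_derivative \<eta> (at x))"
  using C1cD_has_derivative has_derivative_linear by blast

lemma C1cD_continuous: "C1c \<eta> \<Longrightarrow> continuous_on UNIV \<eta>"
  by (intro continuous_at_imp_continuous_on ballI has_derivative_continuous[OF C1cD_has_derivative])

lemma C1c_imp_Cc: "C1c \<eta> \<Longrightarrow> Cc \<eta>"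
  using C1cD_continuous by (auto simp: C1c_def Cc_def)

lemma compact_support_in_UNIV_I:
  assumes "compact K" "\<And>x. x \<notin> K \<Longrightarrow> f x = 0"
  shows "compact_support_in UNIV f"
proof -
  have "closure {x. f x \<noteq> 0} \<subseteq> K"
    using assms by (intro closure_minimal) (auto simp: compact_imp_closed)
  then have "compact (closure {x. f x \<noteq> 0})"
    by (metis assms(1) closed_closure compact_Int_closed inf.absorb2)
  then show ?thesis by (simp add: compact_support_in_def)
qed

lemma Cc_I:
  assumes "continuous_on UNIV f" "compact K" "\<And>x. x \<notin> K \<Longrightarrow> f x = 0"
  shows "Cc f"
  using assms compact_support_in_UNIV_I by (auto simp: Cc_def)

lemma C1c_I:
  assumes der: "\<And>x. (f has_derivative D x) (at x)"
    and cont: "\<And>v. continuous_on UNIV (\<lambda>x. D x v)"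
    and supp: "compact K" "\<And>x. x \<notin> K \<Longrightarrow> f x = 0"
  shows "C1c f"
proof -
  have "frechet_derivative f (at x) = D x" for x
    using frechet_derivative_at[OF der] by simp
  moreover have "compact_support_in UNIV f"
    using supp by (rule compact_support_in_UNIV_I)
  ultimately show ?thesis
    using assms by (auto simp: C1c_def differentiable_def)
qed

lemma Cc_support:
  assumes "Cc f"
  obtains K where "compact K" "\<And>x. x \<notin> K \<Longrightarrow> f x = 0"
proof
  show "compact (closure {x. f x \<noteq> 0})"
    using assms by (simp add: Cc_def compact_support_in_def)
  show "f x = 0" if "x \<notin> closure {x. f x \<noteq> 0}" for x
    using that closure_subset[of "{x. f x \<noteq> 0}"] by auto
qed

lemma Cc_bounded:
  assumes "Cc f"
  obtains B where "B \<ge> 0" "\<And>x. norm (f x) \<le> B"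
proof -
  obtain K where K: "compact K" "\<And>x. x \<notin> K \<Longrightarrow> f x = 0"
    using Cc_support[OF assms] by blast
  have "bounded (f ` K)"
    using assms K by (auto simp: Cc_def intro!: compact_imp_bounded compact_continuous_image
        intro: continuous_on_subset)
  then obtain B where "\<forall>x\<in>K. norm (f x) \<le> B"
    by (auto simp: bounded_iff)
  then have "norm (f x) \<le> max 0 B" for x
    using K(2)[of x] by (cases "x \<in> K") (auto simp: le_max_iff_disj)
  then show ?thesis using that[of "max 0 B"] by simp
qed

lemma frechet_derivative_outside_support:
  assumes "x \<notin> closure {x. \<eta> x \<noteq> 0}"
  shows "frechet_derivative \<eta> (at x) = (\<lambda>_. 0)"
proof -
  have "(\<eta> has_derivative (\<lambda>_. 0)) (at x)"
  proof (rule has_derivative_transform_within_open)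
    show "open (- closure {x. \<eta> x \<noteq> 0})" by auto
    show "((\<lambda>_. 0) has_derivative (\<lambda>_. 0)) (at x)" by simp
    show "0 = \<eta> y" if "y \<in> - closure {x. \<eta> x \<noteq> 0}" for y
      using that closure_subset[of "{x. \<eta> x \<noteq> 0}"] by auto
  qed (use assms in auto)
  then show ?thesis using frechet_derivative_at by metis
qed

lemma Cc_frechet_derivative:
  assumes "C1c \<eta>"
  shows "Cc (\<lambda>x. frechet_derivative \<eta> (at x) v)"
proof (rule Cc_I)
  show "compact (closure {x. \<eta> x \<noteq> 0})"
    using assms by (simp add: C1c_def compact_support_in_def)
  show "frechet_derivative \<eta> (at x) v = 0" if "x \<notin> closure {x. \<eta> x \<noteq> 0}" for x
    using frechet_derivative_outside_support[OF that] by simp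
qed (use assms C1cD_continuous_derivative in auto)

text \<open>A linear map is determined by its values on the basis; this reduces pairings of a derivative with a
  merely measurable field to finitely many measurable coefficients.\<close>

lemma frechet_derivative_expand:
  assumes "linear D"
  shows "D v = (\<Sum>b\<in>Basis. (v \<bullet> b) *\<^sub>R D b)"
proof -
  have "D v = D (\<Sum>b\<in>Basis. (v \<bullet> b) *\<^sub>R b)" by (simp add: euclidean_representation)
  also have "\<dots> = (\<Sum>b\<in>Basis. (v \<bullet> b) *\<^sub>R D b)"
    using assms by (simp add: linear_sum linear_scale)
  finally show ?thesis .
qed

lemma C1c_derivative_bound:
  fixes \<eta> :: "'a::euclidean_space \<Rightarrow> 'b::euclidean_space"
  assumes "C1c \<eta>"
  obtains L where "L \<ge> 0" "\<And>x v. norm (frechet_derivative \<eta> (at x) v) \<le> L * norm v"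
proof -
  have "\<exists>B\<ge>0. \<forall>x. norm (frechet_derivative \<eta> (at x) b) \<le> B" for b
    using Cc_bounded[OF Cc_frechet_derivative[OF assms]] by metis
  then obtain B where B: "\<And>b. B b \<ge> 0" "\<And>b x. norm (frechet_derivative \<eta> (at x) b) \<le> B b"
    by metis
  have "norm (frechet_derivative \<eta> (at x) v) \<le> (\<Sum>b\<in>Basis. B b) * norm v" for x v
  proof -
    have "norm (frechet_derivative \<eta> (at x) v)
        \<le> (\<Sum>b\<in>Basis. norm ((v \<bullet> b) *\<^sub>R frechet_derivative \<eta> (at x) b))"
      unfolding frechet_derivative_expand[OF C1cD_linear[OF assms], of x v] by (rule norm_sum)
    also have "\<dots> \<le> (\<Sum>b\<in>Basis. norm v * B b)"
      by (intro sum_mono) (auto intro!: mult_mono B Basis_le_norm)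
    finally show ?thesis by (simp add: sum_distrib_left mult.commute)
  qed
  then show ?thesis using that[of "\<Sum>b\<in>Basis. B b"] B(1) by (simp add: sum_nonneg)
qed

text \<open>The mean value inequality: a bound on the derivative is a Lipschitz constant.\<close>

lemma C1c_lipschitz:
  fixes \<eta> :: "'a::euclidean_space \<Rightarrow> 'b::euclidean_space"
  assumes "\<And>x v. norm (frechet_derivative \<eta> (at x) v) \<le> L * norm v" "C1c \<eta>"
  shows "norm (\<eta> x - \<eta> y) \<le> L * norm (x - y)"
proof (rule differentiable_bound[of UNIV \<eta> "\<lambda>x. frechet_derivative \<eta> (at x)"])
  show "onorm (frechet_derivative \<eta> (at x)) \<le> L" for x
    using assms by (intro onorm_le) auto
qed (use assms C1cD_has_derivative in auto)

lemma C1c_translate: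
  assumes "C1c \<eta>"
  shows "C1c (\<lambda>z. \<eta> (z - x))"
    and "frechet_derivative (\<lambda>z. \<eta> (z - x)) (at z) = frechet_derivative \<eta> (at (z - x))"
proof -
  have der: "((\<lambda>z. \<eta> (z - x)) has_derivative frechet_derivative \<eta> (at (z - x))) (at z)" for z
  proof -
    have "((\<lambda>z. z - x) has_derivative (\<lambda>h. h)) (at z)"
      by (auto intro!: derivative_eq_intros)
    from diff_chain_at[OF this C1cD_has_derivative[OF assms]] show ?thesis
      by (simp add: o_def)
  qed
  obtain K where K: "compact K" "\<And>x. x \<notin> K \<Longrightarrow> \<eta> x = 0"
    using Cc_support[OF C1c_imp_Cc[OF assms]] by blast
  show "C1c (\<lambda>z. \<eta> (z - x))"
  proof (rule C1c_I[OF der])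
    show "continuous_on UNIV (\<lambda>z. frechet_derivative \<eta> (at (z - x)) v)" for v
      by (rule continuous_on_compose2[OF C1cD_continuous_derivative[OF assms]])
         (auto intro!: continuous_intros)
    show "compact ((+) x ` K)" using K by (intro compact_translation)
    show "\<eta> (z - x) = 0" if "z \<notin> (+) x ` K" for z
      using that K(2)[of "z - x"] by (metis add.commute diff_add_cancel image_eqI)
  qed
  show "frechet_derivative (\<lambda>z. \<eta> (z - x)) (at z) = frechet_derivative \<eta> (at (z - x))"
    using frechet_derivative_at[OF der] by simp
qed

section \<open>Local integrability\<close>

lemma integrable_Cc_scaleR:
  fixes f :: "'a::euclidean_space \<Rightarrow> 'b::euclidean_space" and \<eta> :: "'a \<Rightarrow> real"
  assumes "Cc \<eta>" "loc_integrable_on UNIV f"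
  shows "integrable lebesgue (\<lambda>z. \<eta> z *\<^sub>R f z)"
proof -
  obtain K where K: "compact K" "\<And>x. x \<notin> K \<Longrightarrow> \<eta> x = 0"
    using Cc_support[OF assms(1)] by blast
  obtain B where B: "B \<ge> 0" "\<And>x. norm (\<eta> x) \<le> B"
    using Cc_bounded[OF assms(1)] by blast
  have f: "integrable lebesgue (\<lambda>z. indicator K z *\<^sub>R f z)"
    using assms(2) K(1) by (auto simp: loc_integrable_on_def set_integrable_def)
  have \<eta>[measurable]: "\<eta> \<in> borel_measurable lebesgue"
    using assms(1) by (auto simp: Cc_def intro!: borel_measurable_continuous_onI measurable_completion)
  have "integrable lebesgue (\<lambda>z. \<eta> z *\<^sub>R (indicator K z *\<^sub>R f z))"
  proof (rule Bochner_Integration.integrable_bound)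
    show "integrable lebesgue (\<lambda>z. B *\<^sub>R (indicator K z *\<^sub>R f z))"
      using f by (intro integrable_scaleR_right) auto
    show "(\<lambda>z. \<eta> z *\<^sub>R (indicator K z *\<^sub>R f z)) \<in> borel_measurable lebesgue"
      using \<eta> borel_measurable_integrable[OF f] by (rule borel_measurable_scaleR)
    show "AE z in lebesgue. norm (\<eta> z *\<^sub>R (indicator K z *\<^sub>R f z)) \<le> norm (B *\<^sub>R (indicator K z *\<^sub>R f z))"
      using B by (intro AE_I2) (auto simp: indicator_def intro!: mult_right_mono)
  qed
  moreover have "(\<lambda>z. \<eta> z *\<^sub>R (indicator K z *\<^sub>R f z)) = (\<lambda>z. \<eta> z *\<^sub>R f z)"
    using K(2) by (auto simp: indicator_def fun_eq_iff)
  ultimately show ?thesis by metis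
qed

lemma loc_integrable_imp_measurable:
  fixes f :: "'a::euclidean_space \<Rightarrow> 'b::euclidean_space"
  assumes "loc_integrable_on UNIV f"
  shows "f \<in> borel_measurable lebesgue"
proof (rule borel_measurable_LIMSEQ_metric)
  show "(\<lambda>z. indicator (cball 0 (real n)) z *\<^sub>R f z) \<in> borel_measurable lebesgue" for n
    using assms by (intro borel_measurable_integrable)
      (auto simp: loc_integrable_on_def set_integrable_def)
  show "(\<lambda>n. indicator (cball 0 (real n)) z *\<^sub>R f z) \<longlonglongrightarrow> f z" for z
  proof (rule tendsto_eventually)
    obtain N where "norm z \<le> real N" using real_arch_simple by blast
    then show "\<forall>\<^sub>F n in sequentially. indicator (cball 0 (real n)) z *\<^sub>R f z = f z"
      by (intro eventually_sequentiallyI[of N]) (auto simp: indicator_def)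
  qed
qed

lemma ess_bounded_imp_loc_integrable:
  fixes f :: "'a::euclidean_space \<Rightarrow> 'b::euclidean_space"
  assumes "f \<in> borel_measurable lebesgue" "AE z in lebesgue. norm (f z) \<le> B"
  shows "loc_integrable_on S f"
  unfolding loc_integrable_on_def set_integrable_def
proof (intro allI impI)
  fix K :: "'a set" assume "compact K \<and> K \<subseteq> S"
  then have "K \<in> sets lebesgue" "emeasure lebesgue K < \<infinity>"
    using emeasure_compact_finite[of K] by (auto simp: compact_imp_closed borel_closed)
  then show "integrable lebesgue (\<lambda>x. indicator K x *\<^sub>R f x)"
    using assms by (intro integrableI_bounded_set_indicator[where B=B]) auto
qed

lemma loc_integrable_integrable_on_cbox:
  fixes f :: "'a::euclidean_space \<Rightarrow> 'b::euclidean_space"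
  assumes "loc_integrable_on UNIV f"
  shows "f absolutely_integrable_on cbox a b"
  using assms by (auto simp: loc_integrable_on_def)

section \<open>Lebesgue points\<close>

text \<open>Almost every point is a Lebesgue point; the averages are taken over the cubes with lower
  corner \<open>x\<close>.\<close>

lemma AE_lebesgue_point:
  fixes f :: "'a::euclidean_space \<Rightarrow> real"
  assumes "loc_integrable_on UNIV f"
  shows "AE x in lebesgue.
    ((\<lambda>h. integral (cbox x (x + h *\<^sub>R One)) (\<lambda>z. \<bar>f z - f x\<bar>) /\<^sub>R h ^ DIM('a)) \<longlongrightarrow> 0) (at_right 0)"
proof -
  let ?A = "\<lambda>x h g. integral (cbox x (x + h *\<^sub>R One)) g /\<^sub>R h ^ DIM('a)"
  have abs_int: "(\<lambda>z. \<bar>f z - c\<bar>) integrable_on cbox a b" for a b c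
  proof -
    have "(\<lambda>z. f z - c) absolutely_integrable_on cbox a b"
      using loc_integrable_integrable_on_cbox[OF assms] by (intro set_integral_diff) auto
    then show ?thesis
      by (simp add: absolutely_integrable_on_def)
  qed
  have "\<forall>q. \<exists>N. negligible N \<and> (\<forall>x e. x \<notin> N \<and> 0 < e \<longrightarrow>
      (\<exists>d>0. \<forall>h. 0 < h \<and> h < d \<longrightarrow> norm (?A x h (\<lambda>z. \<bar>f z - q\<bar>) - \<bar>f x - q\<bar>) < e))"
    using integrable_ccontinuous_explicit[OF abs_int] by metis
  then obtain N where N: "\<And>q. negligible (N q)" "\<And>q x e. x \<notin> N q \<Longrightarrow> 0 < e \<Longrightarrow>
      \<exists>d>0. \<forall>h. 0 < h \<and> h < d \<longrightarrow> norm (?A x h (\<lambda>z. \<bar>f z - q\<bar>) - \<bar>f x - q\<bar>) < e"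
    by metis
  have "negligible (\<Union>q\<in>\<rat>. N q)"
    using N(1) countable_rat by (intro negligible_countable_Union) auto
  moreover have "((\<lambda>h. ?A x h (\<lambda>z. \<bar>f z - f x\<bar>)) \<longlongrightarrow> 0) (at_right 0)" if x: "x \<notin> (\<Union>q\<in>\<rat>. N q)" for x
  proof (rule tendstoI)
    fix e :: real assume "e > 0"
    \<comment> \<open>\<open>N q\<close> is the exceptional null set for \<open>\<bar>f - q\<bar>\<close>; off the countable union of these sets, \<open>f x\<close> may
      be replaced by a nearby rational.\<close>
    obtain q where q: "q \<in> \<rat>" "f x - e / 3 < q" "q < f x"
      using Rats_dense_in_real[of "f x - e/3" "f x"] \<open>e > 0\<close> by auto
    with x obtain d where d: "d > 0"
      "\<And>h. 0 < h \<Longrightarrow> h < d \<Longrightarrow> \<bar>?A x h (\<lambda>z. \<bar>f z - q\<bar>) - \<bar>f x - q\<bar>\<bar> < e / 3"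
      using N(2)[of x q "e/3"] \<open>e > 0\<close> by auto
    have "dist (?A x h (\<lambda>z. \<bar>f z - f x\<bar>)) 0 < e" if h: "0 < h" "h < d" for h
    proof -
      let ?Q = "cbox x (x + h *\<^sub>R One)"
      have content: "measure lborel ?Q = h ^ DIM('a)"
        using h by (subst content_cbox) (auto simp: inner_add_left)
      have "integral ?Q (\<lambda>z. \<bar>f z - f x\<bar>) \<le> integral ?Q (\<lambda>z. \<bar>f z - q\<bar> + \<bar>f x - q\<bar>)"
        by (intro integral_le abs_int integrable_add integrable_const) auto
      also have "\<dots> = integral ?Q (\<lambda>z. \<bar>f z - q\<bar>) + \<bar>f x - q\<bar> * h ^ DIM('a)"
        using content by (subst integral_add) (auto intro: abs_int)
      finally have "?A x h (\<lambda>z. \<bar>f z - f x\<bar>) \<le> ?A x h (\<lambda>z. \<bar>f z - q\<bar>) + \<bar>f x - q\<bar>"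
        using h by (simp add: field_simps)
      moreover have "?A x h (\<lambda>z. \<bar>f z - f x\<bar>) \<ge> 0"
        using h by (auto intro!: integral_nonneg abs_int mult_nonneg_nonneg)
      ultimately show ?thesis
        using d(2)[OF h] q(2,3) unfolding dist_real_def by linarith
    qed
    then show "\<forall>\<^sub>F h in at_right 0. dist (?A x h (\<lambda>z. \<bar>f z - f x\<bar>)) 0 < e"
      using \<open>d > 0\<close> by (auto simp: eventually_at_right_field intro!: exI[of _ d])
  qed
  ultimately show ?thesis
    unfolding eventually_ae_filter negligible_iff_null_sets by blast
qed

section \<open>Mollification\<close>

lemma has_derivative_pos_part_square:
  fixes f :: "'a::real_normed_vector \<Rightarrow> real"
  assumes "(f has_derivative f') (at x)"
  shows "((\<lambda>x. (max 0 (f x))\<^sup>2) has_derivative (\<lambda>h. 2 * max 0 (f x) * f' h)) (at x)"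
proof -
  have "((\<lambda>s. (max 0 s)\<^sup>2) has_real_derivative 2 * max 0 s) (at s)" for s :: real
  proof -
    consider "s > 0" | "s < 0" | "s = 0" by linarith
    then show ?thesis
    proof cases
      case 1
      have "((\<lambda>s. s\<^sup>2) has_real_derivative 2 * s) (at s)"
        by (auto intro!: derivative_eq_intros)
      then have "((\<lambda>s. (max 0 s)\<^sup>2) has_real_derivative 2 * s) (at s)"
        by (rule DERIV_cong_ev[THEN iffD1, rotated -1])
           (use 1 in \<open>auto simp: max_def intro!: eventually_mono[OF eventually_nhds_in_open[of "{0<..}" s]]\<close>)
      then show ?thesis using 1 by simp
    next
      case 2
      have "((\<lambda>s. 0) has_real_derivative 0) (at s)" by simp
      then have "((\<lambda>s. (max 0 s)\<^sup>2) has_real_derivative 0) (at s)"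
        by (rule DERIV_cong_ev[THEN iffD1, rotated -1])
           (use 2 in \<open>auto simp: max_def intro!: eventually_mono[OF eventually_nhds_in_open[of "{..<0}" s]]\<close>)
      then show ?thesis using 2 by simp
    next
      case 3
      have "((\<lambda>h. (max 0 h)\<^sup>2 / h) \<longlongrightarrow> 0) (at (0::real))"
      proof (rule Lim_null_comparison)
        show "\<forall>\<^sub>F h in at 0. norm ((max 0 h)\<^sup>2 / h) \<le> \<bar>h\<bar>" for h :: real
          by (rule always_eventually) (auto simp: max_def power2_eq_square)
        show "((\<lambda>h::real. \<bar>h\<bar>) \<longlongrightarrow> 0) (at 0)"
          by (auto intro!: tendsto_eq_intros)
      qed
      then show ?thesis using 3 by (simp add: DERIV_def)
    qed
  qed
  then have "((\<lambda>s. (max 0 s)\<^sup>2) has_derivative (\<lambda>h. 2 * max 0 (f x) * h)) (at (f x))"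
    by (simp add: has_field_derivative_def)
  from diff_chain_at[OF assms this] show ?thesis by (simp add: o_def)
qed

text \<open>The unnormalised kernel at scale \<open>\<epsilon>\<close>, a product over the coordinates \<open>t\<close> of the function
  \<open>(max 0 (t (\<epsilon> - t)))\<^sup>2\<close>. For \<open>\<epsilon> > 0\<close> it is of class \<open>C\<^sup>1\<close> and lives on the cube \<open>[0, \<epsilon>]\<^sup>n\<close>, which matches the corner
  cubes in \<open>AE_lebesgue_point\<close>.\<close>

definition bump :: "real \<Rightarrow> 'a::euclidean_space \<Rightarrow> real" where
  "bump \<epsilon> x = (\<Prod>b\<in>Basis. (max 0 ((x \<bullet> b) * (\<epsilon> - x \<bullet> b)))\<^sup>2)"

lemma bump_nonneg: "bump \<epsilon> x \<ge> 0"
  by (auto simp: bump_def intro!: prod_nonneg)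

lemma bump_eq_0:
  assumes "\<epsilon> > 0" "x \<notin> cbox 0 (\<epsilon> *\<^sub>R One)"
  shows "bump \<epsilon> x = 0"
proof -
  obtain b where b: "b \<in> Basis" "x \<bullet> b < 0 \<or> \<epsilon> < x \<bullet> b"
    using assms by (auto simp: mem_box not_le)
  then have "(x \<bullet> b) * (\<epsilon> - x \<bullet> b) \<le> 0"
    using \<open>\<epsilon> > 0\<close> by (auto simp: mult_le_0_iff)
  then have "(max 0 ((x \<bullet> b) * (\<epsilon> - x \<bullet> b)))\<^sup>2 = 0"
    by (simp add: max_def)
  with b(1) show ?thesis unfolding bump_def by (intro prod_zero) auto
qed

lemma C1c_bump:
  assumes "\<epsilon> > 0"
  shows "C1c (bump \<epsilon> :: 'a::euclidean_space \<Rightarrow> real)"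
proof (rule C1c_I)
  let ?f = "\<lambda>b x. (max 0 ((x \<bullet> b) * (\<epsilon> - x \<bullet> b)))\<^sup>2"
  let ?f' = "\<lambda>b x h. 2 * max 0 ((x \<bullet> b) * (\<epsilon> - x \<bullet> b)) * ((x \<bullet> b) * (- (h \<bullet> b)) + (h \<bullet> b) * (\<epsilon> - x \<bullet> b))"
  let ?D = "\<lambda>x h::'a. \<Sum>b\<in>Basis. ?f' b x h * (\<Prod>c\<in>Basis - {b}. ?f c x)"
  have "(?f b has_derivative ?f' b x) (at x)" for b x :: 'a
    by (rule has_derivative_pos_part_square) (auto intro!: derivative_eq_intros)
  then show "(bump \<epsilon> has_derivative ?D x) (at x)" for x :: 'a
    unfolding bump_def[abs_def] by (intro has_derivative_prod) blast
  show "continuous_on UNIV (\<lambda>x. ?D x v)" for v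
    by (intro continuous_intros)
  show "compact (cbox 0 (\<epsilon> *\<^sub>R One) :: 'a set)" by (rule compact_cbox)
  show "bump \<epsilon> x = 0" if "x \<notin> cbox 0 (\<epsilon> *\<^sub>R One)" for x :: 'a
    by (rule bump_eq_0[OF assms that])
qed

lemma bump_le:
  fixes x :: "'a::euclidean_space"
  assumes "\<epsilon> > 0"
  shows "bump \<epsilon> x \<le> (\<epsilon> ^ 4) ^ DIM('a)"
proof -
  have "max 0 (t * (\<epsilon> - t)) \<le> \<epsilon>\<^sup>2" for t
  proof -
    have "\<epsilon>\<^sup>2 - t * (\<epsilon> - t) = (t - \<epsilon> / 2)\<^sup>2 + 3 / 4 * \<epsilon>\<^sup>2"
      by (simp add: power2_eq_square algebra_simps)
    also have "\<dots> \<ge> 0" by simp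
    finally show ?thesis by simp
  qed
  then have "(max 0 (t * (\<epsilon> - t)))\<^sup>2 \<le> (\<epsilon>\<^sup>2)\<^sup>2" for t
    by (intro power_mono) auto
  then show ?thesis
    unfolding bump_def using prod_mono[of Basis "\<lambda>b. (max 0 ((x \<bullet> b) * (\<epsilon> - x \<bullet> b)))\<^sup>2" "\<lambda>_. (\<epsilon>\<^sup>2)\<^sup>2"]
    by simp
qed

lemma bump_ge:
  fixes x :: "'a::euclidean_space"
  assumes "\<epsilon> > 0" "x \<in> cbox ((\<epsilon> / 4) *\<^sub>R One) ((3 * \<epsilon> / 4) *\<^sub>R One)"
  shows "bump \<epsilon> x \<ge> (\<epsilon> ^ 4 / 256) ^ DIM('a)"
proof -
  have "\<epsilon> ^ 4 / 256 \<le> (max 0 ((x \<bullet> b) * (\<epsilon> - x \<bullet> b)))\<^sup>2" if "b \<in> Basis" for b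
  proof -
    have "\<epsilon> / 4 \<le> x \<bullet> b" "x \<bullet> b \<le> 3 * \<epsilon> / 4"
      using assms that by (auto simp: mem_box)
    then have "(\<epsilon> / 4) * (\<epsilon> / 4) \<le> (x \<bullet> b) * (\<epsilon> - x \<bullet> b)"
      using assms by (intro mult_mono) auto
    then have "(\<epsilon>\<^sup>2 / 16)\<^sup>2 \<le> (max 0 ((x \<bullet> b) * (\<epsilon> - x \<bullet> b)))\<^sup>2"
      by (intro power_mono) (auto simp: power2_eq_square)
    then show ?thesis by (simp add: power_divide)
  qed
  then have "(\<Prod>b\<in>(Basis::'a set). \<epsilon> ^ 4 / 256) \<le> bump \<epsilon> x"
    unfolding bump_def using assms by (intro prod_mono) auto
  then show ?thesis by simp
qed

text \<open>The integral of the kernel at scale \<open>\<epsilon>\<close> over the space \<open>'a\<close>, by which the kernel is normalised.\<close>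

definition bump_mass :: "'a::euclidean_space itself \<Rightarrow> real \<Rightarrow> real" where
  "bump_mass _ \<epsilon> = (LINT z|lebesgue. bump \<epsilon> (z::'a))"

lemma integrable_bump:
  assumes "\<epsilon> > 0"
  shows "integrable lebesgue (bump \<epsilon> :: 'a::euclidean_space \<Rightarrow> real)"
proof -
  have "loc_integrable_on UNIV (\<lambda>_::'a. 1::real)"
    by (rule ess_bounded_imp_loc_integrable[where B=1]) auto
  from integrable_Cc_scaleR[OF C1c_imp_Cc[OF C1c_bump[OF assms]] this] show ?thesis by simp
qed

text \<open>Integrating the lower bound for the kernel over the middle cube \<open>[\<epsilon>/4, 3\<epsilon>/4]\<^sup>n\<close> shows that the mass is at
  least a fixed multiple of the maximum of the kernel times the volume of its support.\<close>

lemma bump_mass_ge: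
  assumes "\<epsilon> > 0"
  shows "bump_mass TYPE('a::euclidean_space) \<epsilon> \<ge> (\<epsilon> ^ 4 / 256 * (\<epsilon> / 2)) ^ DIM('a)"
proof -
  let ?Q = "cbox ((\<epsilon> / 4) *\<^sub>R One) ((3 * \<epsilon> / 4) *\<^sub>R One) :: 'a set"
  have "measure lebesgue ?Q = (\<epsilon> / 2) ^ DIM('a)"
    using assms by (simp add: content_cbox_if box_eq_empty algebra_simps flip: diff_divide_distrib)
  then have "(\<epsilon> ^ 4 / 256 * (\<epsilon> / 2)) ^ DIM('a) = (LINT z|lebesgue. indicator ?Q z * (\<epsilon> ^ 4 / 256) ^ DIM('a))"
    by (simp add: power_mult_distrib[of "\<epsilon> ^ 4 / 256"] del: times_divide_eq_right times_divide_eq_left)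
  also have "\<dots> \<le> (LINT z|lebesgue. bump \<epsilon> (z::'a))"
  proof (rule integral_mono)
    show "integrable lebesgue (\<lambda>z. indicator ?Q z * (\<epsilon> ^ 4 / 256) ^ DIM('a))"
      by (intro integrable_mult_left integrable_real_indicator) (auto simp: emeasure_lborel_cbox_eq)
  qed (use bump_ge[OF assms] bump_nonneg integrable_bump[OF assms] in \<open>auto simp: indicator_def\<close>)
  finally show ?thesis by (simp add: bump_mass_def)
qed

lemma bump_mass_pos: "\<epsilon> > 0 \<Longrightarrow> bump_mass TYPE('a::euclidean_space) \<epsilon> > 0"
  using bump_mass_ge[of \<epsilon>, where 'a='a] by (rule less_le_trans[rotated]) auto

lemma lebesgue_integral_translate:
  fixes f :: "'a::euclidean_space \<Rightarrow> real"
  assumes "f \<in> borel_measurable borel"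
  shows "(LINT z|lebesgue. f (z - x)) = (LINT z|lebesgue. f z)"
proof -
  have "(LINT z|lborel. f z) = (LINT z|distr lborel borel ((+) (- x)). f z)"
    by (simp add: lborel_distr_plus)
  also have "\<dots> = (LINT z|lborel. f (z - x))"
    using assms by (subst integral_distr) auto
  finally show ?thesis
    using assms by (simp add: integral_completion)
qed

text \<open>The mollification of \<open>f\<close> at scale \<open>\<epsilon> > 0\<close>: an average of \<open>f\<close> over the cube \<open>x + [0, \<epsilon>]\<^sup>n\<close> with weight
  \<open>bump\<close>.\<close>

definition mollify :: "real \<Rightarrow> ('a::euclidean_space \<Rightarrow> real) \<Rightarrow> 'a \<Rightarrow> real" where
  "mollify \<epsilon> f x = (LINT z|lebesgue. bump \<epsilon> (z - x) * f z) / bump_mass TYPE('a) \<epsilon>"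

lemma integral_bump_translate:
  fixes x :: "'a::euclidean_space"
  assumes "\<epsilon> > 0"
  shows "(LINT z|lebesgue. bump \<epsilon> (z - x)) = bump_mass TYPE('a) \<epsilon>"
  unfolding bump_mass_def
  by (intro lebesgue_integral_translate borel_measurable_continuous_onI C1cD_continuous C1c_bump assms)

lemma integrable_bump_mult:
  fixes f :: "'a::euclidean_space \<Rightarrow> real"
  assumes "\<epsilon> > 0" "loc_integrable_on UNIV f"
  shows "integrable lebesgue (\<lambda>z. bump \<epsilon> (z - x) * f z)"
  using integrable_Cc_scaleR[OF C1c_imp_Cc[OF C1c_translate(1)[OF C1c_bump]] assms(2)] assms(1) by simp

lemma loc_integrable_const: "loc_integrable_on UNIV (\<lambda>_::'a::euclidean_space. c::'b::euclidean_space)"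
  by (rule ess_bounded_imp_loc_integrable[where B="norm c"]) auto

lemma abs_mollify_le:
  fixes f :: "'a::euclidean_space \<Rightarrow> real"
  assumes f: "loc_integrable_on UNIV f" and bound: "AE z in lebesgue. \<bar>f z\<bar> \<le> B" and "\<epsilon> > 0"
  shows "\<bar>mollify \<epsilon> f x\<bar> \<le> B"
proof -
  have "\<bar>LINT z|lebesgue. bump \<epsilon> (z - x) * f z\<bar> \<le> (LINT z|lebesgue. bump \<epsilon> (z - x) * B)"
  proof -
    have "\<bar>LINT z|lebesgue. bump \<epsilon> (z - x) * f z\<bar> \<le> (LINT z|lebesgue. \<bar>bump \<epsilon> (z - x) * f z\<bar>)"
      by (rule integral_abs_bound)
    also have "\<dots> \<le> (LINT z|lebesgue. bump \<epsilon> (z - x) * B)"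
    proof (rule integral_mono_AE)
      show "AE z in lebesgue. \<bar>bump \<epsilon> (z - x) * f z\<bar> \<le> bump \<epsilon> (z - x) * B"
        using bound by eventually_elim (auto simp: abs_mult bump_nonneg intro!: mult_left_mono)
    qed (intro integrable_abs integrable_bump_mult f loc_integrable_const \<open>\<epsilon> > 0\<close>)+
    finally show ?thesis .
  qed
  also have "\<dots> = bump_mass TYPE('a) \<epsilon> * B"
    by (simp add: integral_bump_translate \<open>\<epsilon> > 0\<close>)
  finally show ?thesis
    using bump_mass_pos[OF \<open>\<epsilon> > 0\<close>, where 'a='a]
    by (simp add: mollify_def pos_divide_le_eq mult.commute)
qed

text \<open>The constant \<open>512\<^sup>n\<close> is the quotient of the bound \<open>(\<epsilon>\<^sup>4)\<^sup>n\<close> for the kernel times the volume \<open>\<epsilon>\<^sup>n\<close> by the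
  lower bound for the mass. It does not depend on \<open>\<epsilon>\<close>, so mollifications converge at every Lebesgue point.\<close>

lemma mollify_diff_const_le:
  fixes f :: "'a::euclidean_space \<Rightarrow> real"
  assumes f: "loc_integrable_on UNIV f" and "\<epsilon> > 0"
  shows "\<bar>mollify \<epsilon> f x - c\<bar>
    \<le> 512 ^ DIM('a) * (integral (cbox x (x + \<epsilon> *\<^sub>R One)) (\<lambda>z. \<bar>f z - c\<bar>) /\<^sub>R \<epsilon> ^ DIM('a))"
proof -
  let ?Q = "cbox x (x + \<epsilon> *\<^sub>R One)" and ?m = "bump_mass TYPE('a) \<epsilon>"
  note m = bump_mass_pos[OF \<open>\<epsilon> > 0\<close>, where 'a='a]
  have set_int: "(\<lambda>z. \<bar>f z - c\<bar>) absolutely_integrable_on ?Q"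
    using loc_integrable_integrable_on_cbox[OF f]
    by (intro set_integrable_abs set_integral_diff) auto
  have "(LINT z|lebesgue. bump \<epsilon> (z - x) * (f z - c)) = (mollify \<epsilon> f x - c) * ?m"
  proof -
    have "(LINT z|lebesgue. bump \<epsilon> (z - x) * (f z - c))
        = (LINT z|lebesgue. bump \<epsilon> (z - x) * f z) - (LINT z|lebesgue. bump \<epsilon> (z - x) * c)"
      unfolding right_diff_distrib
      by (intro Bochner_Integration.integral_diff integrable_bump_mult f loc_integrable_const \<open>\<epsilon> > 0\<close>)
    then show ?thesis
      using m by (simp add: integral_bump_translate \<open>\<epsilon> > 0\<close> mollify_def left_diff_distrib)
  qed
  then have "\<bar>mollify \<epsilon> f x - c\<bar> * ?m \<le> (LINT z|lebesgue. \<bar>bump \<epsilon> (z - x) * (f z - c)\<bar>)"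
    using integral_abs_bound[of lebesgue "\<lambda>z. bump \<epsilon> (z - x) * (f z - c)"] m by (simp add: abs_mult)
  also have "\<dots> \<le> (LINT z|lebesgue. (\<epsilon> ^ 4) ^ DIM('a) * (indicator ?Q z *\<^sub>R \<bar>f z - c\<bar>))"
  proof (rule integral_mono)
    show "integrable lebesgue (\<lambda>z. \<bar>bump \<epsilon> (z - x) * (f z - c)\<bar>)"
      unfolding right_diff_distrib
      by (intro integrable_abs Bochner_Integration.integrable_diff integrable_bump_mult f loc_integrable_const \<open>\<epsilon> > 0\<close>)
    show "integrable lebesgue (\<lambda>z. (\<epsilon> ^ 4) ^ DIM('a) * (indicator ?Q z *\<^sub>R \<bar>f z - c\<bar>))"
      using set_int by (auto simp: set_integrable_def)
    show "\<bar>bump \<epsilon> (z - x) * (f z - c)\<bar> \<le> (\<epsilon> ^ 4) ^ DIM('a) * (indicator ?Q z *\<^sub>R \<bar>f z - c\<bar>)" for z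
    proof (cases "z \<in> ?Q")
      case True
      then show ?thesis
        using bump_le[OF \<open>\<epsilon> > 0\<close>, of "z - x"]
        by (auto simp: abs_mult bump_nonneg intro!: mult_right_mono)
    next
      case False
      moreover have "z \<in> ?Q" if "z - x \<in> cbox 0 (\<epsilon> *\<^sub>R One)"
        using that by (simp add: mem_box inner_diff_left inner_add_left algebra_simps)
      ultimately have "z - x \<notin> cbox 0 (\<epsilon> *\<^sub>R One)" by blast
      then show ?thesis by (simp add: bump_eq_0 \<open>\<epsilon> > 0\<close>)
    qed
  qed
  also have "\<dots> = (\<epsilon> ^ 4) ^ DIM('a) * integral ?Q (\<lambda>z. \<bar>f z - c\<bar>)"
    using set_lebesgue_integral_eq_integral(2)[OF set_int] by (simp add: set_lebesgue_integral_def)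
  finally have *: "\<bar>mollify \<epsilon> f x - c\<bar> * ?m \<le> (\<epsilon> ^ 4) ^ DIM('a) * integral ?Q (\<lambda>z. \<bar>f z - c\<bar>)" .
  have "\<bar>mollify \<epsilon> f x - c\<bar> * (\<epsilon> ^ 4 / 256 * (\<epsilon> / 2)) ^ DIM('a) \<le> \<bar>mollify \<epsilon> f x - c\<bar> * ?m"
    by (intro mult_left_mono bump_mass_ge) (auto simp: \<open>\<epsilon> > 0\<close>)
  also note *
  also have "(\<epsilon> ^ 4 / 256 * (\<epsilon> / 2)) ^ DIM('a) = (\<epsilon> ^ 4) ^ DIM('a) * (\<epsilon> ^ DIM('a) / 512 ^ DIM('a))"
  proof -
    have "\<epsilon> ^ 4 / 256 * (\<epsilon> / 2) = \<epsilon> ^ 4 * (\<epsilon> / 512)" by simp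
    then show ?thesis by (simp only: power_mult_distrib power_divide)
  qed
  finally have "(\<epsilon> ^ 4) ^ DIM('a) * (\<bar>mollify \<epsilon> f x - c\<bar> * (\<epsilon> ^ DIM('a) / 512 ^ DIM('a)))
      \<le> (\<epsilon> ^ 4) ^ DIM('a) * integral ?Q (\<lambda>z. \<bar>f z - c\<bar>)"
    by (simp only: mult_ac)
  then have "\<bar>mollify \<epsilon> f x - c\<bar> * (\<epsilon> ^ DIM('a) / 512 ^ DIM('a)) \<le> integral ?Q (\<lambda>z. \<bar>f z - c\<bar>)"
    using \<open>\<epsilon> > 0\<close> by (subst (asm) mult_le_cancel_left_pos) auto
  then show ?thesis using \<open>\<epsilon> > 0\<close> by (simp add: field_simps)
qed

lemma AE_mollify_tendsto:
  fixes f :: "'a::euclidean_space \<Rightarrow> real"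
  assumes "loc_integrable_on UNIV f"
  shows "AE x in lebesgue. ((\<lambda>\<epsilon>. mollify \<epsilon> f x) \<longlongrightarrow> f x) (at_right 0)"
  using AE_lebesgue_point[OF assms]
proof eventually_elim
  case (elim x)
  have "((\<lambda>\<epsilon>. mollify \<epsilon> f x - f x) \<longlongrightarrow> 0) (at_right 0)"
  proof (rule Lim_null_comparison)
    show "\<forall>\<^sub>F \<epsilon> in at_right 0. norm (mollify \<epsilon> f x - f x)
        \<le> 512 ^ DIM('a) * (integral (cbox x (x + \<epsilon> *\<^sub>R One)) (\<lambda>z. \<bar>f z - f x\<bar>) /\<^sub>R \<epsilon> ^ DIM('a))"
      using eventually_at_right_less[of 0]
    proof eventually_elim
      case (elim \<epsilon>)
      show ?case unfolding real_norm_def by (rule mollify_diff_const_le[OF assms elim])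
    qed
    show "((\<lambda>\<epsilon>. 512 ^ DIM('a) * (integral (cbox x (x + \<epsilon> *\<^sub>R One)) (\<lambda>z. \<bar>f z - f x\<bar>) /\<^sub>R \<epsilon> ^ DIM('a)))
        \<longlongrightarrow> 0) (at_right 0)"
      using tendsto_mult_left[OF elim, of "512 ^ DIM('a)"] by simp
  qed
  then show ?case by (rule LIM_zero_cancel)
qed

lemma AE_mollify_LIMSEQ:
  fixes f :: "'a::euclidean_space \<Rightarrow> real"
  assumes "loc_integrable_on UNIV f"
  shows "AE x in lebesgue. (\<lambda>n. mollify (inverse (real (Suc n))) f x) \<longlonglongrightarrow> f x"
  using AE_mollify_tendsto[OF assms]
proof eventually_elim
  case (elim x)
  have "filterlim (\<lambda>n. inverse (real (Suc n))) (at_right 0) sequentially"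
    using LIMSEQ_inverse_real_of_nat by (auto simp: filterlim_at intro!: always_eventually)
  from filterlim_compose[OF elim this] show ?case .
qed

text \<open>The fundamental lemma of the calculus of variations.\<close>

lemma AE_eq_0_if_integral_C1c_eq_0:
  fixes f :: "'a::euclidean_space \<Rightarrow> real"
  assumes "loc_integrable_on UNIV f"
    and "\<And>\<eta>::'a \<Rightarrow> real. C1c \<eta> \<Longrightarrow> (LINT z|lebesgue. \<eta> z * f z) = 0"
  shows "AE x in lebesgue. f x = 0"
proof -
  have "mollify (inverse (real (Suc n))) f x = 0" for n x
    using assms(2)[OF C1c_translate(1)[OF C1c_bump]] by (simp add: mollify_def)
  with AE_mollify_LIMSEQ[OF assms(1)] show ?thesis
    by (auto simp: LIMSEQ_const_iff simp del: of_nat_Suc elim: eventually_mono)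
qed

lemma has_weak_div_unique:
  assumes "has_weak_div F d" "has_weak_div F d'"
  shows "AE z in lebesgue. d z = d' z"
proof -
  have int: "loc_integrable_on UNIV d" "loc_integrable_on UNIV d'"
    using assms by (auto simp: has_weak_div_def)
  have "AE z in lebesgue. d z - d' z = 0"
  proof (rule AE_eq_0_if_integral_C1c_eq_0)
    show "loc_integrable_on UNIV (\<lambda>z. d z - d' z)"
      using int by (auto simp: loc_integrable_on_def intro!: set_integral_diff)
    show "(LINT z|lebesgue. \<eta> z * (d z - d' z)) = 0" if "C1c \<eta>" for \<eta> :: "real ^ 'a \<Rightarrow> real"
    proof -
      have "(LINT z|lebesgue. \<eta> z * d z) = (LINT z|lebesgue. \<eta> z * d' z)"
        using assms that by (auto simp: has_weak_div_def)
      moreover have "integrable lebesgue (\<lambda>z. \<eta> z * d z)" "integrable lebesgue (\<lambda>z. \<eta> z * d' z)"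
        using int[THEN integrable_Cc_scaleR[OF C1c_imp_Cc[OF that]]] by simp_all
      ultimately show ?thesis by (simp add: right_diff_distrib)
    qed
  qed
  then show ?thesis by simp
qed

section \<open>Weak gradients and Lipschitz representatives\<close>

text \<open>Differentiation under the integral sign, by dominated convergence along sequences: the difference
  quotients of \<open>\<eta>\<close> are bounded by twice its Lipschitz constant and supported in a fixed ball \<open>Q\<close>.\<close>

lemma has_derivative_integral_translate:
  fixes f \<eta> :: "'a::euclidean_space \<Rightarrow> real"
  assumes f: "loc_integrable_on UNIV f" and \<eta>: "C1c \<eta>"
  shows "((\<lambda>x. LINT z|lebesgue. \<eta> (z - x) * f z) has_derivative
    (\<lambda>v. - (LINT z|lebesgue. frechet_derivative \<eta> (at (z - x)) v * f z))) (at x)"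
proof -
  let ?D = "\<lambda>z. frechet_derivative \<eta> (at z)"
  let ?F = "\<lambda>x. LINT z|lebesgue. \<eta> (z - x) * f z"
  let ?F' = "\<lambda>v. - (LINT z|lebesgue. ?D (z - x) v * f z)"
  obtain L where L: "L \<ge> 0" "\<And>x v. norm (?D x v) \<le> L * norm v"
    using C1c_derivative_bound[OF \<eta>] by blast
  define K where "K = closure {x. \<eta> x \<noteq> 0}"
  have "bounded K"
    using \<eta> by (simp add: K_def C1c_def compact_support_in_def compact_imp_bounded)
  then obtain R where R: "\<And>x. x \<in> K \<Longrightarrow> norm x \<le> R"
    by (auto simp: bounded_iff)
  have outside: "\<eta> x = 0" "?D x v = 0" if "norm x > R" for x v
  proof -
    have "x \<notin> K" using R that by force
    then show "\<eta> x = 0" "?D x v = 0"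
      using closure_subset[of "{x. \<eta> x \<noteq> 0}"] frechet_derivative_outside_support[of x \<eta>]
      by (auto simp: K_def)
  qed
  have lin: "linear (?D z)" for z by (rule C1cD_linear[OF \<eta>])
  have int: "integrable lebesgue (\<lambda>z. \<eta> (z - y) * f z)" for y
    using integrable_Cc_scaleR[OF C1c_imp_Cc[OF C1c_translate(1)[OF \<eta>]] f] by simp
  have int': "integrable lebesgue (\<lambda>z. ?D (z - x) v * f z)" for v
    using integrable_Cc_scaleR[OF Cc_frechet_derivative[OF C1c_translate(1)[OF \<eta>]] f]
    by (simp add: C1c_translate(2)[OF \<eta>])
  have "linear ?F'"
    by (intro linearI) (use int' in \<open>simp_all add: linear_add[OF lin] linear_scale[OF lin] distrib_right mult.assoc\<close>)
  moreover have "((\<lambda>y. norm (?F y - ?F x - ?F' (y - x)) / norm (y - x)) \<longlongrightarrow> 0) (at x)"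
    unfolding tendsto_at_iff_sequentially
  proof (intro allI impI)
    fix S :: "nat \<Rightarrow> 'a" assume "\<forall>i. S i \<in> UNIV - {x}" and S: "S \<longlonglongrightarrow> x"
    then have ne: "S i \<noteq> x" for i by auto
    obtain M where M: "\<And>i. norm (S i) \<le> M"
      using convergent_imp_bounded[OF S] by (auto simp: bounded_iff)
    let ?w = "\<lambda>i z. (\<eta> (z - S i) * f z - \<eta> (z - x) * f z + ?D (z - x) (S i - x) * f z) / norm (S i - x)"
    define Q :: "'a set" where "Q = cball 0 (R + max M (norm x))"
    have w_int: "integrable lebesgue (?w i)" for i
      using int int' by auto
    have lim: "(\<lambda>i. LINT z|lebesgue. ?w i z) \<longlonglongrightarrow> integral\<^sup>L lebesgue (\<lambda>_::'a. 0::real)"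
    proof (rule integral_dominated_convergence)
      show "?w i \<in> borel_measurable lebesgue" for i
        using w_int by (rule borel_measurable_integrable)
      show "integrable lebesgue (\<lambda>z. 2 * L * \<bar>indicator Q z *\<^sub>R f z\<bar>)"
        using f by (intro integrable_mult_right integrable_abs)
          (auto simp: loc_integrable_on_def set_integrable_def Q_def)
      show "AE z in lebesgue. norm (?w i z) \<le> 2 * L * \<bar>indicator Q z *\<^sub>R f z\<bar>" for i
      proof (rule AE_I2)
        fix z
        have w_eq: "norm (?w i z) = \<bar>\<eta> (z - S i) - \<eta> (z - x) + ?D (z - x) (S i - x)\<bar> / norm (S i - x) * \<bar>f z\<bar>"
        proof -
          have "?w i z = (\<eta> (z - S i) - \<eta> (z - x) + ?D (z - x) (S i - x)) / norm (S i - x) * f z"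
            by (simp add: left_diff_distrib distrib_right)
          then show ?thesis by (simp only: real_norm_def abs_mult abs_divide abs_norm_cancel)
        qed
        show "norm (?w i z) \<le> 2 * L * \<bar>indicator Q z *\<^sub>R f z\<bar>"
        proof (cases "z \<in> Q")
          case True
          have "\<bar>\<eta> (z - S i) - \<eta> (z - x)\<bar> \<le> L * norm (S i - x)"
            using C1c_lipschitz[OF L(2) \<eta>, of "z - S i" "z - x"] by (simp add: norm_minus_commute)
          moreover have "\<bar>?D (z - x) (S i - x)\<bar> \<le> L * norm (S i - x)"
            using L(2) by simp
          ultimately have "\<bar>\<eta> (z - S i) - \<eta> (z - x) + ?D (z - x) (S i - x)\<bar> \<le> 2 * L * norm (S i - x)"
            by linarith
          then have "\<bar>\<eta> (z - S i) - \<eta> (z - x) + ?D (z - x) (S i - x)\<bar> / norm (S i - x) \<le> 2 * L"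
            using ne[of i] by (simp add: pos_divide_le_eq)
          then have "norm (?w i z) \<le> 2 * L * \<bar>f z\<bar>"
            unfolding w_eq by (rule mult_right_mono) simp
          then show ?thesis using True by simp
        next
          case False
          then have "norm z > R + M" "norm z > R + norm x" by (auto simp: Q_def)
          then have "norm (z - S i) > R" "norm (z - x) > R"
            using norm_triangle_ineq2[of z "S i"] norm_triangle_ineq2[of z x] M[of i] by linarith+
          then show ?thesis using L(1) by (simp add: outside)
        qed
      qed
      show "AE z in lebesgue. (\<lambda>i. ?w i z) \<longlonglongrightarrow> 0"
      proof (rule AE_I2)
        fix z
        have "((\<lambda>y. (\<eta> y - \<eta> (z - x) - ?D (z - x) (y - (z - x))) /\<^sub>R norm (y - (z - x))) \<longlongrightarrow> 0) (at (z - x))"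
          using C1cD_has_derivative[OF \<eta>] by (simp add: has_derivative_at_within)
        moreover have "filterlim (\<lambda>i. z - S i) (at (z - x)) sequentially"
          using S ne by (auto simp: filterlim_at intro!: tendsto_intros always_eventually)
        ultimately have "(\<lambda>i. (\<eta> (z - S i) - \<eta> (z - x) - ?D (z - x) (z - S i - (z - x))) /\<^sub>R norm (z - S i - (z - x))) \<longlonglongrightarrow> 0"
          by (rule filterlim_compose)
        then have "(\<lambda>i. (\<eta> (z - S i) - \<eta> (z - x) - ?D (z - x) (z - S i - (z - x))) /\<^sub>R norm (z - S i - (z - x)) * f z) \<longlonglongrightarrow> 0"
          by (rule tendsto_mult_left_zero)
        moreover have "(\<eta> (z - S i) - \<eta> (z - x) - ?D (z - x) (z - S i - (z - x))) /\<^sub>R norm (z - S i - (z - x)) * f z = ?w i z" for i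
        proof -
          have "z - S i - (z - x) = - (S i - x)" by simp
          then show ?thesis
            by (simp only: linear_neg[OF lin] norm_minus_cancel) (simp add: field_simps)
        qed
        ultimately show "(\<lambda>i. ?w i z) \<longlonglongrightarrow> 0" by simp
      qed
    qed auto
    have eq: "(LINT z|lebesgue. ?w i z) = (?F (S i) - ?F x - ?F' (S i - x)) / norm (S i - x)" for i
      using int int' by simp
    have "(\<lambda>i. norm ((?F (S i) - ?F x - ?F' (S i - x)) / norm (S i - x))) \<longlonglongrightarrow> 0"
      using lim unfolding eq Bochner_Integration.integral_zero by (rule tendsto_norm_zero)
    then show "((\<lambda>y. norm (?F y - ?F x - ?F' (y - x)) / norm (y - x)) \<circ> S) \<longlonglongrightarrow> 0"
      by (simp add: o_def)
  qed
  ultimately show ?thesis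
    by (simp add: has_derivative_iff_norm linear_conv_bounded_linear)
qed

text \<open>\<open>g\<close> is the distributional gradient of the scalar function \<open>f\<close>; all directional derivatives are tested at
  once instead of the partial ones.\<close>

definition has_weak_gradient :: "('a::euclidean_space \<Rightarrow> real) \<Rightarrow> ('a \<Rightarrow> 'a) \<Rightarrow> bool" where
  "has_weak_gradient f g \<longleftrightarrow> loc_integrable_on UNIV f \<and> loc_integrable_on UNIV g \<and>
     (\<forall>\<eta>::'a \<Rightarrow> real. \<forall>v. C1c \<eta> \<longrightarrow>
        (LINT z|lebesgue. frechet_derivative \<eta> (at z) v * f z)
          = - (LINT z|lebesgue. \<eta> z * (g z \<bullet> v)))"

lemma loc_integrable_inner:
  fixes g :: "'a::euclidean_space \<Rightarrow> 'b::euclidean_space"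
  assumes "loc_integrable_on S g"
  shows "loc_integrable_on S (\<lambda>z. g z \<bullet> v)"
  unfolding loc_integrable_on_def
proof (intro allI impI)
  fix K assume "compact K \<and> K \<subseteq> S"
  then have "integrable lebesgue (\<lambda>z. (indicator K z *\<^sub>R g z) \<bullet> v)"
    using assms by (intro integrable_inner_left) (auto simp: loc_integrable_on_def set_integrable_def)
  then show "set_integrable lebesgue K (\<lambda>z. g z \<bullet> v)"
    by (simp add: set_integrable_def)
qed

lemma mollify_differentiable:
  fixes f :: "'a::euclidean_space \<Rightarrow> real"
  assumes "loc_integrable_on UNIV f" "\<epsilon> > 0"
  shows "(mollify \<epsilon> f has_derivative
    (\<lambda>v. - (LINT z|lebesgue. frechet_derivative (bump \<epsilon>) (at (z - x)) v * f z) / bump_mass TYPE('a) \<epsilon>)) (at x)"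
proof -
  have "((\<lambda>x. (LINT z|lebesgue. bump \<epsilon> (z - x) * f z) / bump_mass TYPE('a) \<epsilon>) has_derivative
    (\<lambda>v. - (LINT z|lebesgue. frechet_derivative (bump \<epsilon>) (at (z - x)) v * f z) / bump_mass TYPE('a) \<epsilon>)) (at x)"
    using bounded_linear.has_derivative[OF bounded_linear_divide has_derivative_integral_translate[OF assms(1) C1c_bump[OF assms(2)]]]
    by simp
  then show ?thesis by (simp add: mollify_def[abs_def])
qed

lemma continuous_mollify:
  assumes "loc_integrable_on UNIV f" "\<epsilon> > 0"
  shows "continuous_on UNIV (mollify \<epsilon> f)"
  using mollify_differentiable[OF assms]
  by (intro continuous_at_imp_continuous_on ballI has_derivative_continuous)

lemma mollify_has_derivative:
  fixes f :: "'a::euclidean_space \<Rightarrow> real"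
  assumes fg: "has_weak_gradient f g" and "\<epsilon> > 0"
  shows "(mollify \<epsilon> f has_derivative (\<lambda>v. mollify \<epsilon> (\<lambda>z. g z \<bullet> v) x)) (at x)"
proof -
  have "(LINT z|lebesgue. frechet_derivative (bump \<epsilon>) (at (z - x)) v * f z)
      = - (LINT z|lebesgue. bump \<epsilon> (z - x) * (g z \<bullet> v))" for v
  proof -
    have "(LINT z|lebesgue. frechet_derivative (\<lambda>z. bump \<epsilon> (z - x)) (at z) v * f z)
      = - (LINT z|lebesgue. bump \<epsilon> (z - x) * (g z \<bullet> v))"
      using fg C1c_translate(1)[OF C1c_bump[OF \<open>\<epsilon> > 0\<close>], of x] unfolding has_weak_gradient_def by blast
    then show ?thesis by (simp add: C1c_translate(2)[OF C1c_bump[OF \<open>\<epsilon> > 0\<close>]])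
  qed
  with mollify_differentiable[of f \<epsilon> x] assms show ?thesis
    by (simp add: has_weak_gradient_def mollify_def)
qed

lemma abs_mollify_gradient_le:
  fixes g :: "'a::euclidean_space \<Rightarrow> 'a"
  assumes "loc_integrable_on UNIV g" "AE z in lebesgue. norm (g z) \<le> L" "\<epsilon> > 0"
  shows "\<bar>mollify \<epsilon> (\<lambda>z. g z \<bullet> v) x\<bar> \<le> L * norm v"
proof (rule abs_mollify_le)
  show "AE z in lebesgue. \<bar>g z \<bullet> v\<bar> \<le> L * norm v"
    using assms(2)
  proof eventually_elim
    case (elim z)
    then show ?case
      using Cauchy_Schwarz_ineq2[of "g z" v] by (meson mult_right_mono norm_ge_zero order_trans)
  qed
qed (use assms loc_integrable_inner in auto)

lemma AE_lebesgue_dense: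
  fixes P :: "'a::euclidean_space \<Rightarrow> bool"
  assumes "AE z in lebesgue. P z"
  shows "closure {z. P z} = UNIV"
proof -
  obtain N where N: "N \<in> null_sets lebesgue" "{z. \<not> P z} \<subseteq> N"
    using assms by (auto simp: eventually_ae_filter)
  have "- closure {z. P z} \<subseteq> N"
    using N(2) closure_subset[of "{z. P z}"] by blast
  then have "negligible (- closure {z. P z})"
    using N(1) negligible_subset negligible_iff_null_sets by metis
  then have "- closure {z. P z} = {}"
    by (meson closed_closure open_Compl open_not_negligible)
  then show ?thesis by auto
qed

text \<open>The mollifications of \<open>f\<close> are Lipschitz with the constant \<open>max 0 L\<close>, since their gradients are averages of \<open>g\<close>.
  They converge to \<open>f\<close> almost everywhere, so \<open>f\<close> is Lipschitz on a dense set and extends from there.\<close>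

lemma lipschitz_representative:
  fixes f :: "'a::euclidean_space \<Rightarrow> real"
  assumes fg: "has_weak_gradient f g" and g: "AE z in lebesgue. norm (g z) \<le> L"
  shows "\<exists>H. (\<exists>L. L-lipschitz_on UNIV H) \<and> (AE z in lebesgue. H z = f z)"
proof -
  have f: "loc_integrable_on UNIV f" and g': "loc_integrable_on UNIV g"
    using fg by (auto simp: has_weak_gradient_def)
  let ?f = "\<lambda>n. mollify (inverse (real (Suc n))) f"
  let ?G = "{x. (\<lambda>n. ?f n x) \<longlonglongrightarrow> f x}"
  have AE_G: "AE x in lebesgue. (\<lambda>n. ?f n x) \<longlonglongrightarrow> f x"
    by (rule AE_mollify_LIMSEQ[OF f])
  have lip: "\<bar>?f n x - ?f n y\<bar> \<le> max 0 L * norm (x - y)" for n x y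
  proof -
    have pos: "inverse (real (Suc n)) > 0" by simp
    show ?thesis
      unfolding real_norm_def[symmetric]
    proof (rule differentiable_bound[of UNIV])
      fix x
      show "(?f n has_derivative (\<lambda>v. mollify (inverse (real (Suc n))) (\<lambda>z. g z \<bullet> v) x)) (at x within UNIV)"
        using mollify_has_derivative[OF fg pos] by simp
      have "\<bar>mollify (inverse (real (Suc n))) (\<lambda>z. g z \<bullet> v) x\<bar> \<le> max 0 L * norm v" for v
        by (rule order_trans[OF abs_mollify_gradient_le[OF g' g pos] mult_right_mono]) auto
      then show "onorm (\<lambda>v. mollify (inverse (real (Suc n))) (\<lambda>z. g z \<bullet> v) x) \<le> max 0 L"
        by (intro onorm_le) auto
    qed auto
  qed
  have "(max 0 L)-lipschitz_on ?G f"
  proof (rule lipschitz_onI)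
    fix x y assume "x \<in> ?G" "y \<in> ?G"
    then have "(\<lambda>n. \<bar>?f n x - ?f n y\<bar>) \<longlonglongrightarrow> \<bar>f x - f y\<bar>"
      by (intro tendsto_intros) auto
    then have "\<bar>f x - f y\<bar> \<le> max 0 L * norm (x - y)"
      by (rule LIMSEQ_le_const2) (use lip in auto)
    then show "dist (f x) (f y) \<le> max 0 L * dist x y"
      by (simp add: dist_norm)
  qed auto
  then obtain H where "(max 0 L)-lipschitz_on (closure ?G) H" "\<And>x. x \<in> ?G \<Longrightarrow> H x = f x"
    using lipschitz_extend_closure by blast
  then show ?thesis
    using AE_lebesgue_dense[OF AE_G] AE_G by (auto elim!: eventually_mono)
qed

lemma continuous_AE_eq_imp_eq:
  fixes f g :: "'a::euclidean_space \<Rightarrow> real"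
  assumes "continuous_on UNIV f" "continuous_on UNIV g" "AE z in lebesgue. f z = g z"
  shows "f = g"
proof -
  have "closed {z. f z = g z}"
    using assms by (intro closed_Collect_eq) auto
  then show ?thesis
    using AE_lebesgue_dense[OF assms(3)] by (auto simp: closure_closed)
qed

lemma continuous_imp_lebesgue_measurable:
  fixes f :: "'a::euclidean_space \<Rightarrow> 'b::euclidean_space"
  shows "continuous_on UNIV f \<Longrightarrow> f \<in> borel_measurable lebesgue"
  by (auto intro!: borel_measurable_continuous_onI measurable_completion)

section \<open>The chain rule for weak divergences\<close>

lemma C1c_mult_compose:
  fixes \<eta> u :: "'a::euclidean_space \<Rightarrow> real"
  assumes \<eta>: "C1c \<eta>" and u: "\<And>x. (u has_derivative D x) (at x)"
    and D: "\<And>v. continuous_on UNIV (\<lambda>x. D x v)"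
    and \<theta>: "\<And>s. (\<theta> has_real_derivative \<theta>' s) (at s)" "continuous_on UNIV \<theta>'"
  shows "C1c (\<lambda>x. \<eta> x * \<theta> (u x))"
    and "frechet_derivative (\<lambda>x. \<eta> x * \<theta> (u x)) (at x) v
      = frechet_derivative \<eta> (at x) v * \<theta> (u x) + \<eta> x * \<theta>' (u x) * D x v"
proof -
  let ?D = "\<lambda>x v. \<eta> x * (\<theta>' (u x) * D x v) + frechet_derivative \<eta> (at x) v * \<theta> (u x)"
  have der: "((\<lambda>x. \<eta> x * \<theta> (u x)) has_derivative ?D x) (at x)" for x
  proof -
    have "((\<theta> \<circ> u) has_derivative ((*) (\<theta>' (u x))) \<circ> D x) (at x)"
      using \<theta>(1) by (intro diff_chain_at u) (simp add: has_field_derivative_def)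
    then show ?thesis
      by (intro has_derivative_mult C1cD_has_derivative[OF \<eta>]) (simp add: o_def)
  qed
  have u_cont: "continuous_on UNIV u"
    using u by (intro continuous_at_imp_continuous_on ballI has_derivative_continuous)
  have \<theta>_cont: "continuous_on UNIV \<theta>"
    using \<theta>(1) DERIV_isCont continuous_at_imp_continuous_on by blast
  obtain K where K: "compact K" "\<And>x. x \<notin> K \<Longrightarrow> \<eta> x = 0"
    using Cc_support[OF C1c_imp_Cc[OF \<eta>]] by blast
  show "C1c (\<lambda>x. \<eta> x * \<theta> (u x))"
  proof (rule C1c_I[OF der _ K(1)])
    show "continuous_on UNIV (\<lambda>x. ?D x v)" for v
      by (intro continuous_intros D C1cD_continuous[OF \<eta>] C1cD_continuous_derivative[OF \<eta>]
          continuous_on_compose2[OF \<theta>(2) u_cont] continuous_on_compose2[OF \<theta>_cont u_cont]) auto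
  qed (simp add: K(2))
  show "frechet_derivative (\<lambda>x. \<eta> x * \<theta> (u x)) (at x) v
      = frechet_derivative \<eta> (at x) v * \<theta> (u x) + \<eta> x * \<theta>' (u x) * D x v"
    using fun_cong[OF frechet_derivative_at[OF der], of x v] by simp
qed

lemma integrable_C1c_derivative_field:
  fixes \<eta> :: "'a::euclidean_space \<Rightarrow> real"
  assumes "C1c \<eta>" "loc_integrable_on UNIV F"
  shows "integrable lebesgue (\<lambda>z. frechet_derivative \<eta> (at z) (F z))"
proof -
  have "integrable lebesgue (\<lambda>z. \<Sum>b\<in>Basis. frechet_derivative \<eta> (at z) b *\<^sub>R (F z \<bullet> b))"
    by (intro Bochner_Integration.integrable_sum integrable_Cc_scaleR Cc_frechet_derivative loc_integrable_inner assms)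
  moreover have "(\<Sum>b\<in>Basis. frechet_derivative \<eta> (at z) b *\<^sub>R (F z \<bullet> b)) = frechet_derivative \<eta> (at z) (F z)" for z
    using frechet_derivative_expand[OF C1cD_linear[OF assms(1)], of z "F z"] by (simp add: mult.commute)
  ultimately show ?thesis by simp
qed

text \<open>The identity \<open>div (\<theta>(h) F) = \<theta>'(h) g \<bullet> F + \<theta>(h) div F\<close>, tested against \<open>\<eta>\<close>. For a mollification
  \<open>h\<^sub>n\<close> of \<open>h\<close>, the product \<open>\<eta> \<theta>(h\<^sub>n)\<close> is an admissible test function for the divergence of \<open>F\<close>; both \<open>h\<^sub>n\<close>
  and its gradient stay bounded and converge almost everywhere.\<close>

lemma weak_div_chain_rule:
  fixes h :: "real ^ 'n::finite \<Rightarrow> real"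
  assumes h: "has_weak_gradient h g"
    and h_le: "AE z in lebesgue. \<bar>h z\<bar> \<le> B" and g_le: "AE z in lebesgue. norm (g z) \<le> L"
    and F: "has_weak_div F d"
    and \<theta>: "\<And>s. (\<theta> has_real_derivative \<theta>' s) (at s)" and \<theta>': "continuous_on UNIV \<theta>'"
    and \<eta>: "C1c \<eta>"
  shows "(LINT z|lebesgue. frechet_derivative \<eta> (at z) (F z) * \<theta> (h z)
    + \<eta> z * (\<theta>' (h z) * (g z \<bullet> F z) + \<theta> (h z) * d z)) = 0"
proof -
  have loc: "loc_integrable_on UNIV h" "loc_integrable_on UNIV g"
      "loc_integrable_on UNIV F" "loc_integrable_on UNIV d"
    using h F by (auto simp: has_weak_gradient_def has_weak_div_def)
  note [measurable] = loc[THEN loc_integrable_imp_measurable]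
  let ?\<epsilon> = "\<lambda>n. inverse (real (Suc n))"
  have pos: "?\<epsilon> n > 0" for n by simp
  let ?h = "\<lambda>n. mollify (?\<epsilon> n) h"
  let ?g = "\<lambda>n v z. mollify (?\<epsilon> n) (\<lambda>y. g y \<bullet> v) z"
  let ?D = "\<lambda>z. frechet_derivative \<eta> (at z)"
  have \<theta>_cont: "continuous_on UNIV \<theta>"
    using \<theta> DERIV_isCont continuous_at_imp_continuous_on by blast
  have [measurable]: "\<theta> \<in> borel_measurable borel" "\<theta>' \<in> borel_measurable borel"
    using \<theta>_cont \<theta>' by (auto intro: borel_measurable_continuous_onI)
  have [measurable]: "\<eta> \<in> borel_measurable lebesgue" "?h n \<in> borel_measurable lebesgue"
      "?g n v \<in> borel_measurable lebesgue" for n v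
    by (intro continuous_imp_lebesgue_measurable continuous_mollify C1cD_continuous[OF \<eta>] loc
        loc_integrable_inner pos)+
  have [measurable]: "(\<lambda>z. ?D z (F z)) \<in> borel_measurable lebesgue"
    using integrable_C1c_derivative_field[OF \<eta> loc(3)] by (rule borel_measurable_integrable)
  have h_der: "(?h n has_derivative (\<lambda>v. ?g n v z)) (at z)" for n z
    by (rule mollify_has_derivative[OF h pos])
  have g_expand: "?g n v z = (\<Sum>b\<in>Basis. (v \<bullet> b) * ?g n b z)" for n v z
    using frechet_derivative_expand[OF has_derivative_linear[OF h_der[of n z]], of v]
    unfolding real_scaleR_def .
  have [measurable]: "(\<lambda>z. ?g n (F z) z) \<in> borel_measurable lebesgue" for n
    unfolding g_expand[of n "F _"] by measurable
  obtain c where c: "c \<ge> 0" "\<And>s. \<bar>s\<bar> \<le> B \<Longrightarrow> \<bar>\<theta> s\<bar> \<le> c" "\<And>s. \<bar>s\<bar> \<le> B \<Longrightarrow> \<bar>\<theta>' s\<bar> \<le> c"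
  proof -
    have "bounded (\<theta> ` {-B..B})" "bounded (\<theta>' ` {-B..B})"
      using \<theta>_cont \<theta>' by (auto intro!: compact_imp_bounded compact_continuous_image intro: continuous_on_subset)
    then obtain c1 c2 where c12: "\<forall>s\<in>{-B..B}. \<bar>\<theta> s\<bar> \<le> c1" "\<forall>s\<in>{-B..B}. \<bar>\<theta>' s\<bar> \<le> c2"
      by (auto simp: bounded_iff)
    show ?thesis
    proof (rule that[of "max 0 (max c1 c2)"])
      fix s assume "\<bar>s\<bar> \<le> B"
      then have "s \<in> {-B..B}" by (simp add: abs_le_iff)
      with c12 show "\<bar>\<theta> s\<bar> \<le> max 0 (max c1 c2)" "\<bar>\<theta>' s\<bar> \<le> max 0 (max c1 c2)"
        by (auto simp: le_max_iff_disj)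
    qed simp
  qed
  have h_le': "\<bar>?h n z\<bar> \<le> B" for n z
    by (rule abs_mollify_le[OF loc(1) h_le pos])
  have g_le': "\<bar>?g n v z\<bar> \<le> L * norm v" for n v z
    by (rule abs_mollify_gradient_le[OF loc(2) g_le pos])
  let ?w = "\<lambda>n z. ?D z (F z) * \<theta> (?h n z) + \<eta> z * (\<theta>' (?h n z) * ?g n (F z) z + \<theta> (?h n z) * d z)"
  have "(LINT z|lebesgue. ?w n z) = 0" for n
  proof -
    let ?\<zeta> = "\<lambda>z. \<eta> z * \<theta> (?h n z)"
    have cont: "continuous_on UNIV (\<lambda>x. ?g n v x)" for v
      by (intro continuous_mollify loc_integrable_inner loc pos)
    note \<zeta> = C1c_mult_compose[OF \<eta> h_der cont \<theta> \<theta>']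
    have "(LINT z|lebesgue. frechet_derivative ?\<zeta> (at z) (F z) + ?\<zeta> z * d z) = 0"
      using F \<zeta>(1) integrable_C1c_derivative_field[OF \<zeta>(1) loc(3)]
        integrable_Cc_scaleR[OF C1c_imp_Cc[OF \<zeta>(1)] loc(4)]
      by (simp add: has_weak_div_def)
    then show ?thesis unfolding \<zeta>(2) by (simp add: algebra_simps)
  qed
  moreover have "(\<lambda>n. LINT z|lebesgue. ?w n z) \<longlonglongrightarrow> (LINT z|lebesgue. ?D z (F z) * \<theta> (h z)
    + \<eta> z * (\<theta>' (h z) * (g z \<bullet> F z) + \<theta> (h z) * d z))"
  proof (rule integral_dominated_convergence)
    \<comment> \<open>Since \<open>\<bar>\<nabla>h\<^sub>n\<bar> \<le> L\<close> and \<open>\<theta>\<close>, \<open>\<theta>'\<close> are bounded by \<open>c\<close> on the range of \<open>h\<^sub>n\<close>, this function dominates; it is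
      integrable for any locally integrable \<open>F\<close> and \<open>d\<close>, because \<open>\<eta>\<close> has compact support.\<close>
    let ?b = "\<lambda>z. c * \<bar>?D z (F z)\<bar> + (c * L * norm (\<eta> z *\<^sub>R F z) + c * \<bar>\<eta> z *\<^sub>R d z\<bar>)"
    show "integrable lebesgue ?b"
      by (intro Bochner_Integration.integrable_add integrable_mult_right integrable_abs integrable_norm
          integrable_C1c_derivative_field integrable_Cc_scaleR C1c_imp_Cc \<eta> loc)
    show "AE z in lebesgue. norm (?w n z) \<le> ?b z" for n
    proof (rule AE_I2)
      fix z
      have "\<bar>?D z (F z) * \<theta> (?h n z)\<bar> \<le> c * \<bar>?D z (F z)\<bar>"
        using mult_left_mono[OF c(2)[OF h_le'[of n z]], of "\<bar>?D z (F z)\<bar>"] by (simp add: abs_mult mult.commute)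
      moreover have "\<bar>\<eta> z * (\<theta>' (?h n z) * ?g n (F z) z)\<bar> \<le> c * L * norm (\<eta> z *\<^sub>R F z)"
      proof -
        have "\<bar>\<theta>' (?h n z)\<bar> * \<bar>?g n (F z) z\<bar> \<le> c * (L * norm (F z))"
          by (intro mult_mono c(3) h_le' g_le' c(1)) auto
        then have "\<bar>\<eta> z\<bar> * (\<bar>\<theta>' (?h n z)\<bar> * \<bar>?g n (F z) z\<bar>) \<le> \<bar>\<eta> z\<bar> * (c * (L * norm (F z)))"
          by (rule mult_left_mono) simp
        then show ?thesis by (simp add: abs_mult mult_ac)
      qed
      moreover have "\<bar>\<eta> z * (\<theta> (?h n z) * d z)\<bar> \<le> c * \<bar>\<eta> z *\<^sub>R d z\<bar>"
        using mult_left_mono[OF c(2)[OF h_le'[of n z]], of "\<bar>\<eta> z * d z\<bar>"] by (simp add: abs_mult mult_ac)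
      ultimately show "norm (?w n z) \<le> ?b z"
        unfolding real_norm_def distrib_left by linarith
    qed
    have "AE z in lebesgue. \<forall>b\<in>Basis. (\<lambda>n. ?g n b z) \<longlonglongrightarrow> g z \<bullet> b"
      by (intro AE_finite_allI AE_mollify_LIMSEQ loc_integrable_inner loc) auto
    then show "AE z in lebesgue. (\<lambda>n. ?w n z) \<longlonglongrightarrow> ?D z (F z) * \<theta> (h z)
        + \<eta> z * (\<theta>' (h z) * (g z \<bullet> F z) + \<theta> (h z) * d z)"
      using AE_mollify_LIMSEQ[OF loc(1)]
    proof eventually_elim
      case (elim z)
      have "(\<lambda>n. \<Sum>b\<in>Basis. (F z \<bullet> b) * ?g n b z) \<longlonglongrightarrow> (\<Sum>b\<in>Basis. (F z \<bullet> b) * (g z \<bullet> b))"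
        using elim(1) by (intro tendsto_intros) auto
      then have "(\<lambda>n. ?g n (F z) z) \<longlonglongrightarrow> g z \<bullet> F z"
        unfolding g_expand[of _ "F z"] by (simp add: euclidean_inner[of "g z" "F z"] mult.commute)
      moreover have "(\<lambda>n. \<theta> (?h n z)) \<longlonglongrightarrow> \<theta> (h z)" "(\<lambda>n. \<theta>' (?h n z)) \<longlonglongrightarrow> \<theta>' (h z)"
        using continuous_on_tendsto_compose[OF \<theta>_cont elim(2)]
          continuous_on_tendsto_compose[OF \<theta>' elim(2)] by simp_all
      ultimately show ?case by (intro tendsto_intros)
    qed
  qed measurable
  ultimately show ?thesis by (simp add: LIMSEQ_const_iff)
qed

text \<open>The function \<open>\<theta>(s) = s / (s\<^sup>2 + (max 0 (m\<^sup>2 - s\<^sup>2))\<^sup>2)\<close> is of class \<open>C\<^sup>1\<close> on the whole line and agrees to first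
  order with \<open>1 / s\<close> where \<open>\<bar>s\<bar> \<ge> m\<close>.\<close>

lemma smooth_reciprocal:
  fixes m :: real
  assumes "m > 0"
  obtains \<theta> \<theta>' where "\<And>s. (\<theta> has_real_derivative \<theta>' s) (at s)" "continuous_on UNIV \<theta>'"
    "\<And>s. \<bar>s\<bar> \<ge> m \<Longrightarrow> \<theta> s = 1 / s" "\<And>s. \<bar>s\<bar> \<ge> m \<Longrightarrow> \<theta>' s = - 1 / s\<^sup>2"
proof -
  define q where "q s = s\<^sup>2 + (max 0 (m\<^sup>2 - s\<^sup>2))\<^sup>2" for s
  define q' where "q' s = 2 * s - 4 * s * max 0 (m\<^sup>2 - s\<^sup>2)" for s
  have q_pos: "q s \<noteq> 0" for s
  proof (cases "s = 0")
    case False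
    then have "s\<^sup>2 > 0" by simp
    then show ?thesis unfolding q_def by (metis add_pos_nonneg less_irrefl zero_le_power2)
  qed (use assms in \<open>simp add: q_def\<close>)
  have q_der: "(q has_real_derivative q' s) (at s)" for s
  proof -
    have "((\<lambda>s. m\<^sup>2 - s\<^sup>2) has_derivative (\<lambda>h. - (2 * s * h))) (at s)"
      by (auto intro!: derivative_eq_intros)
    moreover have "((\<lambda>s. s\<^sup>2) has_derivative (\<lambda>h. 2 * s * h)) (at s)"
      by (auto intro!: derivative_eq_intros)
    ultimately have "((\<lambda>s. s\<^sup>2 + (max 0 (m\<^sup>2 - s\<^sup>2))\<^sup>2) has_derivative
        (\<lambda>h. 2 * s * h + 2 * max 0 (m\<^sup>2 - s\<^sup>2) * - (2 * s * h))) (at s)"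
      by (intro has_derivative_add has_derivative_pos_part_square)
    then show ?thesis
      unfolding has_field_derivative_def q_def q'_def
      by (rule has_derivative_eq_rhs) (auto simp: algebra_simps)
  qed
  show ?thesis
  proof (rule that[of "\<lambda>s. s / q s" "\<lambda>s. (q s - s * q' s) / (q s * q s)"])
    show "((\<lambda>s. s / q s) has_real_derivative (q s - s * q' s) / (q s * q s)) (at s)" for s
      by (rule derivative_eq_intros q_der q_pos refl | simp)+
    show "continuous_on UNIV (\<lambda>s. (q s - s * q' s) / (q s * q s))"
      using q_pos unfolding q_def q'_def by (intro continuous_intros) auto
    fix s assume "\<bar>s\<bar> \<ge> m"
    then have "m\<^sup>2 \<le> s\<^sup>2" using assms by (metis abs_le_square_iff abs_of_pos)
    then have "q s = s\<^sup>2" "q' s = 2 * s" and "s \<noteq> 0"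
      using \<open>m \<le> \<bar>s\<bar>\<close> assms by (auto simp: q_def q'_def)
    then show "s / q s = 1 / s" "(q s - s * q' s) / (q s * q s) = - 1 / s\<^sup>2"
      by (auto simp: power2_eq_square field_simps)
  qed
qed

text \<open>If \<open>g \<bullet> F = h div F\<close> with \<open>g\<close> the weak gradient of \<open>h\<close>, then \<open>F / h\<close> is divergence free where \<open>h\<close> stays away
  from \<open>0\<close>. This is the chain rule for \<open>\<theta>(s) = 1 / s\<close>, whose right-hand side is \<open>- (g \<bullet> F) / h\<^sup>2 + div F / h = 0\<close>.\<close>

lemma div_zero_on_divide:
  fixes h :: "real ^ 'n::finite \<Rightarrow> real"
  assumes h: "has_weak_gradient h g"
    and h_le: "AE z in lebesgue. \<bar>h z\<bar> \<le> B" and g_le: "AE z in lebesgue. norm (g z) \<le> L"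
    and F: "has_weak_div F d"
    and transport: "AE z in lebesgue. g z \<bullet> F z = h z * d z"
    and H: "AE z in lebesgue. H z = h z" "continuous_on UNIV H"
    and \<Omega>: "m > 0" "\<And>z. z \<in> \<Omega> \<Longrightarrow> \<bar>H z\<bar> \<ge> m"
  shows "div_zero_on \<Omega> (\<lambda>z. (c / H z) *\<^sub>R F z)"
  unfolding div_zero_on_def
proof (intro conjI allI impI)
  have loc: "loc_integrable_on UNIV F"
    using F by (simp add: has_weak_div_def)
  show "loc_integrable_on \<Omega> (\<lambda>z. (c / H z) *\<^sub>R F z)"
    unfolding loc_integrable_on_def set_integrable_def
  proof (intro allI impI)
    fix K assume K: "compact K \<and> K \<subseteq> \<Omega>"
    show "integrable lebesgue (\<lambda>z. indicator K z *\<^sub>R (c / H z) *\<^sub>R F z)"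
    proof (rule Bochner_Integration.integrable_bound)
      show "integrable lebesgue (\<lambda>z. (\<bar>c\<bar> / m) *\<^sub>R (indicator K z *\<^sub>R F z))"
        using loc K by (intro integrable_scaleR_right) (auto simp: loc_integrable_on_def set_integrable_def)
      have [measurable]: "H \<in> borel_measurable lebesgue" "F \<in> borel_measurable lebesgue"
          "K \<in> sets lebesgue"
        using H K by (auto intro!: continuous_imp_lebesgue_measurable loc_integrable_imp_measurable[OF loc]
            simp: compact_imp_closed borel_closed)
      show "(\<lambda>z. indicator K z *\<^sub>R (c / H z) *\<^sub>R F z) \<in> borel_measurable lebesgue"
        by measurable
      show "AE z in lebesgue. norm (indicator K z *\<^sub>R (c / H z) *\<^sub>R F z)
          \<le> norm ((\<bar>c\<bar> / m) *\<^sub>R (indicator K z *\<^sub>R F z))"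
      proof (rule AE_I2)
        fix z
        have "\<bar>c\<bar> / \<bar>H z\<bar> * norm (F z) \<le> \<bar>c\<bar> / m * norm (F z)" if "z \<in> K"
        proof (intro mult_right_mono divide_left_mono mult_pos_pos)
          show "m \<le> \<bar>H z\<bar>" using that K \<Omega>(2) by blast
          with \<Omega>(1) show "0 < \<bar>H z\<bar>" by linarith
        qed (use \<Omega>(1) in auto)
        then show "norm (indicator K z *\<^sub>R (c / H z) *\<^sub>R F z)
            \<le> norm ((\<bar>c\<bar> / m) *\<^sub>R (indicator K z *\<^sub>R F z))"
          using \<Omega>(1) by (cases "z \<in> K") auto
      qed
    qed
  qed
  fix \<eta> :: "real ^ 'n \<Rightarrow> real" assume "Cinfc \<Omega> \<eta>"
  then have \<eta>: "C1c \<eta>" and supp: "closure {z. \<eta> z \<noteq> 0} \<subseteq> \<Omega>"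
    unfolding Cinfc_def C1c_def compact_support_in_def by blast+
  let ?D = "\<lambda>z. frechet_derivative \<eta> (at z)"
  obtain \<theta> \<theta>' where \<theta>: "\<And>s. (\<theta> has_real_derivative \<theta>' s) (at s)" "continuous_on UNIV \<theta>'"
    "\<And>s. \<bar>s\<bar> \<ge> m \<Longrightarrow> \<theta> s = 1 / s" "\<And>s. \<bar>s\<bar> \<ge> m \<Longrightarrow> \<theta>' s = - 1 / s\<^sup>2"
    using smooth_reciprocal[OF \<Omega>(1)] by blast
  have lhs: "indicator \<Omega> z *\<^sub>R ?D z ((c / H z) *\<^sub>R F z) = c / H z * ?D z (F z)" for z
  proof (cases "z \<in> \<Omega>")
    case True
    then show ?thesis using linear_scale[OF C1cD_linear[OF \<eta>], of z] by simp
  next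
    case False
    then have "z \<notin> closure {z. \<eta> z \<noteq> 0}" using supp by blast
    then show ?thesis using False by (simp add: frechet_derivative_outside_support)
  qed
  have [measurable]: "H \<in> borel_measurable lebesgue" "(\<lambda>z. ?D z (F z)) \<in> borel_measurable lebesgue"
    using H(2) integrable_C1c_derivative_field[OF \<eta> loc]
    by (auto intro: continuous_imp_lebesgue_measurable)
  have meas: "(\<lambda>z. c / H z * ?D z (F z)) \<in> borel_measurable lebesgue"
    by measurable
  have AE_eq: "AE z in lebesgue. c / H z * ?D z (F z)
     = c * (?D z (F z) * \<theta> (h z) + \<eta> z * (\<theta>' (h z) * (g z \<bullet> F z) + \<theta> (h z) * d z))"
    using transport H(1)
  proof eventually_elim
    case (elim z)
    show ?case
    proof (cases "z \<in> \<Omega>")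
      case True
      then have *: "\<bar>h z\<bar> \<ge> m" "h z \<noteq> 0" using \<Omega>(1) \<Omega>(2)[of z] elim by auto
      have "\<theta>' (h z) * (g z \<bullet> F z) + \<theta> (h z) * d z = 0"
        unfolding elim(1) \<theta>(3,4)[OF *(1)] using *(2) by (simp add: power2_eq_square)
      then show ?thesis
        using elim(2) \<theta>(3)[OF *(1)] by simp
    next
      case False
      then have "z \<notin> closure {z. \<eta> z \<noteq> 0}" using supp by blast
      then have "?D z = (\<lambda>_. 0)" "\<eta> z = 0"
        using closure_subset[of "{z. \<eta> z \<noteq> 0}"] frechet_derivative_outside_support[of z \<eta>] by auto
      then show ?thesis by simp
    qed
  qed
  have "(LINT z:\<Omega>|lebesgue. ?D z ((c / H z) *\<^sub>R F z))
      = (LINT z|lebesgue. c * (?D z (F z) * \<theta> (h z) + \<eta> z * (\<theta>' (h z) * (g z \<bullet> F z) + \<theta> (h z) * d z)))"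
    unfolding set_lebesgue_integral_def lhs
    by (rule integral_cong_AE[OF meas borel_measurable_AE[OF meas AE_eq] AE_eq])
  also have "\<dots> = 0"
    using weak_div_chain_rule[OF h h_le g_le F \<theta>(1,2) \<eta>] by simp
  finally show "(LINT z:\<Omega>|lebesgue. ?D z ((c / H z) *\<^sub>R F z)) = 0" .
qed

section \<open>Commuting vector fields in the plane\<close>

lemma perp_simps [simp]: "perp y $ 1 = - (y $ 2)" "perp y $ 2 = y $ 1"
  by (simp_all add: perp_def)

lemma norm_perp: "norm (perp y) = norm y"
  by (simp add: norm_vec_def L2_set_def sum_2 add.commute)

lemma inner_perp_commute: "x \<bullet> perp y = - (perp x \<bullet> y)"
  by (simp add: inner_vec_def sum_2)

text \<open>Both sides are orthogonal to \<open>perp v\<close>. This identity turns the bracket tested against \<open>\<eta> perp v\<close> into a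
  derivative of \<open>\<eta>\<close> in the direction \<open>v\<close>.\<close>

lemma perp_contraction: "(x \<bullet> perp v) *\<^sub>R y - (y \<bullet> perp v) *\<^sub>R x = (x \<bullet> perp y) *\<^sub>R v"
  by (simp add: vec_eq_iff forall_2 inner_vec_def sum_2 algebra_simps)

lemma perp_linear: "linear perp"
  by (intro linearI) (simp_all add: vec_eq_iff forall_2)

lemma C1c_scaleR_const:
  fixes \<eta> :: "'a::euclidean_space \<Rightarrow> real" and e :: "'b::euclidean_space"
  assumes "C1c \<eta>"
  shows "C1c (\<lambda>z. \<eta> z *\<^sub>R e)"
    and "frechet_derivative (\<lambda>z. \<eta> z *\<^sub>R e) (at z) v = frechet_derivative \<eta> (at z) v *\<^sub>R e"
proof -
  have der: "((\<lambda>z. \<eta> z *\<^sub>R e) has_derivative (\<lambda>v. frechet_derivative \<eta> (at z) v *\<^sub>R e)) (at z)" for z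
    by (rule has_derivative_scaleR_left[OF C1cD_has_derivative[OF assms]])
  obtain K where K: "compact K" "\<And>x. x \<notin> K \<Longrightarrow> \<eta> x = 0"
    using Cc_support[OF C1c_imp_Cc[OF assms]] by blast
  show "C1c (\<lambda>z. \<eta> z *\<^sub>R e)"
    by (rule C1c_I[OF der _ K(1)]) (auto intro!: continuous_intros C1cD_continuous_derivative[OF assms] simp: K(2))
  show "frechet_derivative (\<lambda>z. \<eta> z *\<^sub>R e) (at z) v = frechet_derivative \<eta> (at z) v *\<^sub>R e"
    using fun_cong[OF frechet_derivative_at[OF der], of z v] by simp
qed

lemma ess_bounded_on_UNIV:
  "ess_bounded_on UNIV f \<longleftrightarrow> f \<in> borel_measurable lebesgue \<and> (\<exists>B. AE z in lebesgue. norm (f z) \<le> B)"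
  by (simp only: ess_bounded_on_def lebesgue_on_UNIV_eq)

text \<open>The chosen representative \<open>weak_div F\<close> inherits boundedness from any bounded divergence, because weak
  divergences are unique up to null sets.\<close>

lemma AE_bounded_weak_div:
  assumes "bounded_divergence F"
  shows "has_weak_div F (weak_div F)"
    and "\<exists>B. AE z in lebesgue. \<bar>weak_div F z\<bar> \<le> B"
proof -
  obtain d where d: "has_weak_div F d" "ess_bounded_on UNIV d"
    using assms by (auto simp: bounded_divergence_def)
  show *: "has_weak_div F (weak_div F)"
    unfolding weak_div_def using d(1) by (rule someI[where P="has_weak_div F"])
  obtain B where "AE z in lebesgue. norm (d z) \<le> B"
    using d(2) by (auto simp: ess_bounded_on_UNIV)
  then have "AE z in lebesgue. \<bar>weak_div F z\<bar> \<le> B"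
    using has_weak_div_unique[OF * d(1)] by eventually_elim simp
  then show "\<exists>B. AE z in lebesgue. \<bar>weak_div F z\<bar> \<le> B" by blast
qed

text \<open>The distributional form of \<open>\<nabla>\<^sup>\<bottom>(X \<bullet> Y\<^sup>\<bottom>) = W\<close>, solved for the gradient.\<close>

lemma commuting_fields_weak_gradient:
  fixes X Y :: "real ^ 2 \<Rightarrow> real ^ 2"
  assumes comm: "commuting_fields X Y"
    and h: "loc_integrable_on UNIV (\<lambda>z. X z \<bullet> perp (Y z))"
    and g: "loc_integrable_on UNIV (\<lambda>z. - perp (weak_div Y z *\<^sub>R X z - weak_div X z *\<^sub>R Y z))"
  shows "has_weak_gradient (\<lambda>z. X z \<bullet> perp (Y z))
    (\<lambda>z. - perp (weak_div Y z *\<^sub>R X z - weak_div X z *\<^sub>R Y z))"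
  unfolding has_weak_gradient_def
proof (intro conjI allI impI h g)
  fix \<eta> :: "real ^ 2 \<Rightarrow> real" and v :: "real ^ 2" assume \<eta>: "C1c \<eta>"
  let ?D = "\<lambda>z. frechet_derivative \<eta> (at z)"
  let ?W = "\<lambda>z. weak_div Y z *\<^sub>R X z - weak_div X z *\<^sub>R Y z"
  let ?\<phi> = "\<lambda>z. \<eta> z *\<^sub>R perp v"
  have "X z \<bullet> frechet_derivative ?\<phi> (at z) (Y z) + weak_div Y z * (X z \<bullet> ?\<phi> z)
      - Y z \<bullet> frechet_derivative ?\<phi> (at z) (X z) - weak_div X z * (Y z \<bullet> ?\<phi> z)
    = ?D z v * (X z \<bullet> perp (Y z)) + \<eta> z * (- perp (?W z) \<bullet> v)" for z
  proof -
    note lin = C1cD_linear[OF \<eta>, of z]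
    have "?D z v * (X z \<bullet> perp (Y z)) = ?D z ((X z \<bullet> perp v) *\<^sub>R Y z - (Y z \<bullet> perp v) *\<^sub>R X z)"
      unfolding perp_contraction by (simp add: linear_scale[OF lin])
    also have "\<dots> = (X z \<bullet> perp v) * ?D z (Y z) - (Y z \<bullet> perp v) * ?D z (X z)"
      by (simp add: linear_diff[OF lin] linear_scale[OF lin])
    finally have "?D z v * (X z \<bullet> perp (Y z)) = \<dots>" .
    moreover have "- perp (?W z) \<bullet> v = ?W z \<bullet> perp v"
      using inner_perp_commute[of "?W z" v] by simp
    ultimately show ?thesis
      by (simp add: C1c_scaleR_const(2)[OF \<eta>] inner_diff_left algebra_simps)
  qed
  then have "lie_bracket X Y ?\<phi>
      = (LINT z|lebesgue. ?D z v * (X z \<bullet> perp (Y z)) + \<eta> z * (- perp (?W z) \<bullet> v))"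
    unfolding lie_bracket_def by presburger
  also have "\<dots> = (LINT z|lebesgue. ?D z v * (X z \<bullet> perp (Y z))) + (LINT z|lebesgue. \<eta> z * (- perp (?W z) \<bullet> v))"
    using integrable_Cc_scaleR[OF Cc_frechet_derivative[OF \<eta>] h]
      integrable_Cc_scaleR[OF C1c_imp_Cc[OF \<eta>] loc_integrable_inner[OF g]]
    by (intro Bochner_Integration.integral_add) simp_all
  finally show "(LINT z|lebesgue. ?D z v * (X z \<bullet> perp (Y z))) = - (LINT z|lebesgue. \<eta> z * (- perp (?W z) \<bullet> v))"
    using comm C1c_scaleR_const(1)[OF \<eta>, of "perp v"] by (simp add: commuting_fields_def)
qed

lemma has_weak_div_diff:
  assumes F: "has_weak_div F d" and G: "has_weak_div G e"
  shows "has_weak_div (\<lambda>z. F z - G z) (\<lambda>z. d z - e z)"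
  unfolding has_weak_div_def
proof (intro conjI allI impI)
  have loc: "loc_integrable_on UNIV F" "loc_integrable_on UNIV G"
      "loc_integrable_on UNIV d" "loc_integrable_on UNIV e"
    using F G by (auto simp: has_weak_div_def)
  then show "loc_integrable_on UNIV (\<lambda>z. F z - G z)" "loc_integrable_on UNIV (\<lambda>z. d z - e z)"
    by (auto simp: loc_integrable_on_def intro!: set_integral_diff)
  fix \<eta> :: "real ^ 'a \<Rightarrow> real" assume \<eta>: "C1c \<eta>"
  have "(LINT z|lebesgue. frechet_derivative \<eta> (at z) (F z - G z))
      = (LINT z|lebesgue. frechet_derivative \<eta> (at z) (F z)) - (LINT z|lebesgue. frechet_derivative \<eta> (at z) (G z))"
    using integrable_C1c_derivative_field[OF \<eta>] loc by (simp add: linear_diff[OF C1cD_linear[OF \<eta>]])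
  moreover have "(LINT z|lebesgue. \<eta> z * (d z - e z)) = (LINT z|lebesgue. \<eta> z * d z) - (LINT z|lebesgue. \<eta> z * e z)"
    using integrable_Cc_scaleR[OF C1c_imp_Cc[OF \<eta>] loc(3)] integrable_Cc_scaleR[OF C1c_imp_Cc[OF \<eta>] loc(4)]
    by (simp add: right_diff_distrib)
  ultimately show "(LINT z|lebesgue. frechet_derivative \<eta> (at z) (F z - G z)) = - (LINT z|lebesgue. \<eta> z * (d z - e z))"
    using F G \<eta> by (simp add: has_weak_div_def)
qed

text \<open>Any Lipschitz function that agrees almost everywhere with \<open>X \<bullet> perp Y\<close> is the one described by
  \<open>H_W\<close>.\<close>

lemma H_W_eqI:
  assumes "L-lipschitz_on UNIV H" "AE z in lebesgue. H z = X z \<bullet> perp (Y z)"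
  shows "H_W X Y = H"
  unfolding H_W_def
proof (rule the_equality)
  fix K assume K: "(\<exists>L. L-lipschitz_on UNIV K) \<and> (AE z in lebesgue. K z = X z \<bullet> perp (Y z))"
  show "K = H"
  proof (rule continuous_AE_eq_imp_eq)
    show "continuous_on UNIV K" "continuous_on UNIV H"
      using K assms(1) lipschitz_on_continuous_on by blast+
    show "AE z in lebesgue. K z = H z"
      using conjunct2[OF K] assms(2) by eventually_elim simp
  qed
qed (use assms in blast)

theorem proposition1p7:
  fixes p :: ereal
    and X Y :: "real ^ 2 \<Rightarrow> real ^ 2"
    and T C \<kappa> :: real
    and \<phi>X \<phi>Y :: "real \<Rightarrow> real ^ 2 \<Rightarrow> real ^ 2"
    and \<xi>X \<xi>Y :: "real \<Rightarrow> real ^ 2 \<Rightarrow> real"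
  defines "\<Omega> \<equiv> Omega X Y C \<kappa>"
    and "\<rho> \<equiv> (\<lambda>z. sgn \<kappa> * (1 / H_W X Y z))"
  assumes "p \<ge> 1"
    and "Lp \<infinity> X" "W1p p X" "Lp \<infinity> Y" "W1p p Y"
    and "bounded_divergence X" "bounded_divergence Y"
    and "commuting_fields X Y"
    and "T > 0" "C > 1"
    and "regular_lagrangian_flow X \<phi>X" "jacobian_density \<phi>X \<xi>X" "jacobian_bounds T C \<xi>X"
    and "regular_lagrangian_flow Y \<phi>Y" "jacobian_density \<phi>Y \<xi>Y" "jacobian_bounds T C \<xi>Y"
    and "\<kappa> \<noteq> 0"
  shows "steady_nearly_incompressible \<Omega> X \<and> steady_nearly_incompressible \<Omega> Y \<and>
    (\<exists>L. L-lipschitz_on \<Omega> \<rho>) \<and> bounded (\<rho> ` \<Omega>) \<and>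
    steady_density \<Omega> X \<rho> \<and> steady_density \<Omega> Y \<rho> \<and>
    div_zero_on \<Omega> (\<lambda>z. \<rho> z *\<^sub>R X z) \<and> div_zero_on \<Omega> (\<lambda>z. \<rho> z *\<^sub>R Y z) \<and>
    div_zero_on \<Omega> (\<lambda>z. \<rho> z *\<^sub>R (X z - Y z))"
proof -
  define h where "h z = X z \<bullet> perp (Y z)" for z
  define g where "g z = - perp (weak_div Y z *\<^sub>R X z - weak_div X z *\<^sub>R Y z)" for z
  obtain A B where meas: "X \<in> borel_measurable lebesgue" "Y \<in> borel_measurable lebesgue"
    and A: "AE z in lebesgue. norm (X z) \<le> A" and B: "AE z in lebesgue. norm (Y z) \<le> B"
    using \<open>Lp \<infinity> X\<close> \<open>Lp \<infinity> Y\<close> by (auto simp: Lp_def ess_bounded_on_UNIV)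
  note divX = AE_bounded_weak_div[OF \<open>bounded_divergence X\<close>]
    and divY = AE_bounded_weak_div[OF \<open>bounded_divergence Y\<close>]
  obtain a b where a: "AE z in lebesgue. \<bar>weak_div X z\<bar> \<le> a" and b: "AE z in lebesgue. \<bar>weak_div Y z\<bar> \<le> b"
    using divX(2) divY(2) by blast
  have div_meas: "weak_div X \<in> borel_measurable lebesgue" "weak_div Y \<in> borel_measurable lebesgue"
    using divX(1) divY(1) by (auto simp: has_weak_div_def intro: loc_integrable_imp_measurable)
  have perp_meas: "perp \<in> borel_measurable borel"
    by (intro borel_measurable_continuous_onI linear_continuous_on linear_conv_bounded_linear[THEN iffD1] perp_linear)
  have h_meas: "h \<in> borel_measurable lebesgue"
    unfolding h_def[abs_def]
    by (intro borel_measurable_inner meas measurable_compose[OF meas(2) perp_meas])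
  have g_meas: "g \<in> borel_measurable lebesgue"
    unfolding g_def[abs_def]
    by (intro borel_measurable_uminus measurable_compose[OF _ perp_meas] borel_measurable_diff
        borel_measurable_scaleR meas div_meas)
  have h_le: "AE z in lebesgue. \<bar>h z\<bar> \<le> A * B"
    using A B
  proof eventually_elim
    case (elim z)
    have "\<bar>h z\<bar> \<le> norm (X z) * norm (Y z)"
      unfolding h_def using Cauchy_Schwarz_ineq2[of "X z" "perp (Y z)"] by (simp add: norm_perp)
    also have "\<dots> \<le> A * B"
      by (intro mult_mono elim norm_ge_zero order_trans[OF norm_ge_zero elim(1)])
    finally show ?case .
  qed
  have g_le: "AE z in lebesgue. norm (g z) \<le> b * A + a * B"
    using A B a b
  proof eventually_elim
    case (elim z)
    have "norm (g z) \<le> \<bar>weak_div Y z\<bar> * norm (X z) + \<bar>weak_div X z\<bar> * norm (Y z)"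
      unfolding g_def norm_minus_cancel norm_perp
      using norm_triangle_ineq4[of "weak_div Y z *\<^sub>R X z" "weak_div X z *\<^sub>R Y z"] by simp
    also have "\<dots> \<le> b * A + a * B"
      using elim by (intro add_mono mult_mono) auto
    finally show ?case .
  qed
  have grad: "has_weak_gradient h g"
    unfolding h_def[abs_def] g_def[abs_def]
  proof (rule commuting_fields_weak_gradient[OF \<open>commuting_fields X Y\<close>])
    show "loc_integrable_on UNIV (\<lambda>z. X z \<bullet> perp (Y z))"
      by (rule ess_bounded_imp_loc_integrable[where B="A * B"])
        (use h_meas h_le in \<open>simp_all add: h_def[abs_def]\<close>)
    show "loc_integrable_on UNIV (\<lambda>z. - perp (weak_div Y z *\<^sub>R X z - weak_div X z *\<^sub>R Y z))"
      by (rule ess_bounded_imp_loc_integrable[where B="b * A + a * B"])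
        (use g_meas g_le in \<open>simp_all add: g_def[abs_def]\<close>)
  qed
  obtain H L where H: "L-lipschitz_on UNIV H" "AE z in lebesgue. H z = h z"
    using lipschitz_representative[OF grad g_le] by blast
  have H_W: "H_W X Y = H"
    using H_W_eqI[OF H(1)] H(2) by (simp add: h_def)
  have H_cont: "continuous_on UNIV H"
    using H(1) by (rule lipschitz_on_continuous_on)
  define m where "m = \<bar>\<kappa>\<bar> / C"
  have m: "m > 0" using \<open>\<kappa> \<noteq> 0\<close> \<open>C > 1\<close> by (simp add: m_def)
  have \<Omega>_bounds: "sgn (H z) = sgn \<kappa>" "m \<le> \<bar>H z\<bar>" "\<bar>H z\<bar> \<le> C * \<bar>\<kappa>\<bar>" if "z \<in> \<Omega>" for z
  proof -
    have "m < sgn \<kappa> * H z \<and> sgn \<kappa> * H z < C * \<bar>\<kappa>\<bar>"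
      using that \<open>\<kappa> \<noteq> 0\<close> by (auto simp: \<Omega>_def Omega_def H_W m_def sgn_if split: if_splits)
    with m show "sgn (H z) = sgn \<kappa>" "m \<le> \<bar>H z\<bar>" "\<bar>H z\<bar> \<le> C * \<bar>\<kappa>\<bar>"
      using \<open>\<kappa> \<noteq> 0\<close> by (auto simp: sgn_if split: if_splits)
  qed
  have open_\<Omega>: "open \<Omega>"
    unfolding \<Omega>_def Omega_def H_W using H_cont by (intro open_vimage) auto
  then have \<Omega>_sets: "\<Omega> \<in> sets lebesgue" by (simp add: borel_open)
  have \<rho>_eq: "\<rho> z = sgn \<kappa> / H z" for z
    by (simp add: \<rho>_def H_W)
  have \<rho>_abs: "\<rho> z = 1 / \<bar>H z\<bar>" if "z \<in> \<Omega>" for z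
    using \<Omega>_bounds[OF that] m by (simp add: \<rho>_eq sgn_if split: if_splits)
  have \<rho>_bounds: "1 / (C * \<bar>\<kappa>\<bar>) \<le> \<rho> z" "\<rho> z \<le> 1 / m" if "z \<in> \<Omega>" for z
    using \<Omega>_bounds[OF that] m \<rho>_abs[OF that] by (auto intro!: divide_left_mono)
  have div_zero: "div_zero_on \<Omega> (\<lambda>z. \<rho> z *\<^sub>R F z)"
    if "has_weak_div F d" "AE z in lebesgue. g z \<bullet> F z = h z * d z" for F d
    unfolding \<rho>_eq
    by (rule div_zero_on_divide[OF grad h_le g_le that H(2) H_cont m \<Omega>_bounds(2)])
  \<comment> \<open>\<open>- perp W \<bullet> X = W \<bullet> perp X\<close>, and in \<open>W = div Y X - div X Y\<close> the multiple of \<open>X\<close> is orthogonal to \<open>perp X\<close>;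
    likewise for \<open>Y\<close>.\<close>
  have gX: "g z \<bullet> X z = h z * weak_div X z" and gY: "g z \<bullet> Y z = h z * weak_div Y z" for z
    by (simp_all add: g_def h_def inner_vec_def sum_2 algebra_simps)
  have dX: "div_zero_on \<Omega> (\<lambda>z. \<rho> z *\<^sub>R X z)" and dY: "div_zero_on \<Omega> (\<lambda>z. \<rho> z *\<^sub>R Y z)"
    using div_zero[OF divX(1)] div_zero[OF divY(1)] gX gY by auto
  have dXY: "div_zero_on \<Omega> (\<lambda>z. \<rho> z *\<^sub>R (X z - Y z))"
    by (rule div_zero[OF has_weak_div_diff[OF divX(1) divY(1)]])
      (simp add: inner_diff_right gX gY right_diff_distrib)
  have \<rho>_lip: "(1 / m\<^sup>2 * L)-lipschitz_on \<Omega> \<rho>"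
  proof (rule lipschitz_onI)
    fix x y assume xy: "x \<in> \<Omega>" "y \<in> \<Omega>"
    then have ne: "H x \<noteq> 0" "H y \<noteq> 0" using \<Omega>_bounds(2) m by fastforce+
    have "dist (\<rho> x) (\<rho> y) = \<bar>H x - H y\<bar> / (\<bar>H x\<bar> * \<bar>H y\<bar>)"
    proof -
      have "\<rho> x - \<rho> y = sgn \<kappa> * (H y - H x) / (H x * H y)"
        using ne by (simp add: \<rho>_eq field_simps)
      then show ?thesis
        using \<open>\<kappa> \<noteq> 0\<close> by (simp add: dist_real_def abs_mult abs_divide abs_sgn_eq abs_minus_commute)
    qed
    also have "\<dots> \<le> \<bar>H x - H y\<bar> / (m * m)"
      using \<Omega>_bounds(2) xy m ne by (intro divide_left_mono mult_mono mult_pos_pos) auto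
    also have "\<dots> \<le> (L * dist x y) / (m * m)"
      using lipschitz_onD[OF H(1), of x y] m by (intro divide_right_mono) (auto simp: dist_real_def)
    finally show "dist (\<rho> x) (\<rho> y) \<le> 1 / m\<^sup>2 * L * dist x y"
      by (simp add: power2_eq_square)
  qed (use lipschitz_on_nonneg[OF H(1)] in simp)
  have \<rho>_bdd: "bounded (\<rho> ` \<Omega>)"
    unfolding bounded_iff
  proof (intro exI ballI)
    fix y assume "y \<in> \<rho> ` \<Omega>"
    then obtain z where z: "z \<in> \<Omega>" "y = \<rho> z" by blast
    have "\<rho> z \<ge> 0" using \<rho>_abs[OF z(1)] by simp
    with \<rho>_bounds(2)[OF z(1)] show "norm y \<le> 1 / m" by (simp add: z)
  qed
  have \<rho>_meas: "\<rho> \<in> borel_measurable (lebesgue_on \<Omega>)"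
    using continuous_imp_measurable_on_sets_lebesgue[OF lipschitz_on_continuous_on[OF \<rho>_lip] \<Omega>_sets] .
  have \<rho>_AE: "\<exists>C>0. AE z in lebesgue_on \<Omega>. \<rho> z \<in> {1 / C..C}"
  proof (intro exI conjI)
    define C' where "C' = max (C * \<bar>\<kappa>\<bar>) (1 / m)"
    have "C * \<bar>\<kappa>\<bar> > 0" using \<open>\<kappa> \<noteq> 0\<close> \<open>C > 1\<close> by simp
    then show "C' > 0" by (simp add: C'_def less_max_iff_disj)
    have "1 / C' \<le> 1 / (C * \<bar>\<kappa>\<bar>)"
      using \<open>C * \<bar>\<kappa>\<bar> > 0\<close> \<open>C' > 0\<close> \<open>\<kappa> \<noteq> 0\<close> \<open>C > 1\<close>
      by (intro divide_left_mono mult_pos_pos) (simp_all add: C'_def)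
    then have "\<rho> z \<in> {1 / C'..C'}" if "z \<in> \<Omega>" for z
      using \<rho>_bounds[OF that] by (auto simp: C'_def intro: order_trans)
    then show "AE z in lebesgue_on \<Omega>. \<rho> z \<in> {1 / C'..C'}"
      by (intro AE_I2) (simp add: space_restrict_space)
  qed
  have sX: "steady_density \<Omega> X \<rho>" and sY: "steady_density \<Omega> Y \<rho>"
    using \<rho>_meas \<rho>_AE dX dY by (auto simp: steady_density_def)
  have snx: "steady_nearly_incompressible \<Omega> F"
    if "F \<in> borel_measurable lebesgue" "AE z in lebesgue. norm (F z) \<le> M" "steady_density \<Omega> F \<rho>" for F M
  proof -
    have "AE z in lebesgue_on \<Omega>. norm (F z) \<le> M"
      using that(2) \<Omega>_sets by (subst AE_restrict_space_iff) (auto elim: eventually_mono)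
    then have "ess_bounded_on \<Omega> F"
      using that(1) by (auto simp: ess_bounded_on_def intro: measurable_restrict_space1)
    then show ?thesis
      using that ess_bounded_imp_loc_integrable[OF that(1,2)]
      by (auto simp: steady_nearly_incompressible_def)
  qed
  show ?thesis
    using snx[OF meas(1) A sX] snx[OF meas(2) B sY] \<rho>_lip \<rho>_bdd sX sY dX dY dXY by blast
qed

end
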